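(* Let $\kappa \in \mathbb{R}$ and let $(X,d)$ be a complete $\mathrm{CAT}(\kappa)$-space. Let $A \subseteq X$ be a closed and connected subset. If $\kappa > 0$, assume further that $X$ is locally compact and that the diameter of $A$ with respect to the length metric $d_A$ is at most $D_\kappa$. If $A$ is locally convex, then $A$ is $D_\kappa$-convex.
   Context: $D_\kappa = \pi/\sqrt{\kappa}$ if $\kappa > 0$ and $D_\kappa = \infty$ otherwise. A geodesic is an isometric embedding of a compact interval (also its image). $\mathrm{CAT}(\kappa)$-spaces are in the sense of Bridson--Haefliger: any two points at distance less than $D_\kappa$ are joined by a geodesic, and geodesic triangles of perimeter less than $2D_\kappa$ are at most as thick as their comparison triangles in the model plane of constant curvature $\kappa$. A subset $A \subseteq X$ is $D_\kappa$-convex if any two points $a,b \in A$ with $d(a,b) < D_\kappa$ can be joined by a geodesic in $X$ and every such geodesic is contained in $A$ (for $\kappa \le 0$ this is ordinary convexity). A closed subset $A\subseteq X$ is locally convex at $a \in A$ if there is an $\varepsilon > 0$ such that $A \cap B(a,\varepsilon)$ is convex in the open ball $B(a,\varepsilon)$, i.e. any two points of $A \cap B(a,\varepsilon)$ can be joined by a geodesic contained in $B(a,\varepsilon)$ and every such geodesic is contained in $A$. $A$ is locally convex if it is locally convex at each of its points. The length metric on $A$ is $d_A(a,b) = \inf_\gamma l(\gamma)$, where the infimum is over rectifiable paths $\gamma$ in $A$ joining $a$ to $b$ and $l$ denotes length with respect to $d$ ($d_A(a,b) = \infty$ if there is no such path). *)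

theory Defs
  imports "HOL-Analysis.Analysis"
begin

definition D_bound :: "real \<Rightarrow> ennreal" where
  "D_bound \<kappa> = (if \<kappa> > 0 then ennreal (pi / sqrt \<kappa>) else \<infinity>)"

text \<open>
  A geodesic from \<open>x\<close> to \<open>y\<close> is recorded through its image. The carrier and the distance are
  parameters so that the same notion serves the space itself and the model planes.
\<close>

definition geodesic_segment_in ::
  "'a set \<Rightarrow> ('a \<Rightarrow> 'a \<Rightarrow> real) \<Rightarrow> 'a \<Rightarrow> 'a \<Rightarrow> 'a set \<Rightarrow> bool" where
  "geodesic_segment_in M d x y S \<longleftrightarrow>
     (\<exists>a b c. a \<le> b \<and> c ` {a..b} \<subseteq> M \<and>
        (\<forall>s\<in>{a..b}. \<forall>t\<in>{a..b}. d (c s) (c t) = \<bar>s - t\<bar>) \<and>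
        c a = x \<and> c b = y \<and> S = c ` {a..b})"

abbreviation geodesic_segment :: "'a::metric_space \<Rightarrow> 'a \<Rightarrow> 'a set \<Rightarrow> bool" where
  "geodesic_segment \<equiv> geodesic_segment_in UNIV dist"

text \<open>
  The model plane of constant curvature \<open>\<kappa>\<close>, following Bridson and Haefliger: the unit sphere with
  the angular distance (\<open>\<kappa> > 0\<close>), the Euclidean plane (\<open>\<kappa> = 0\<close>), or the upper sheet of the
  hyperboloid with the hyperbolic distance (\<open>\<kappa> < 0\<close>), with the distance rescaled by
  \<open>1 / sqrt \<bar>\<kappa>\<bar>\<close> when \<open>\<kappa> \<noteq> 0\<close>. All three are realised inside \<open>\<real>\<^sup>3\<close>.
\<close>

definition lorentz :: "real^3 \<Rightarrow> real^3 \<Rightarrow> real" where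
  "lorentz u v = u $ 1 * v $ 1 + u $ 2 * v $ 2 - u $ 3 * v $ 3"

definition model_plane :: "real \<Rightarrow> (real^3) set" where
  "model_plane \<kappa> =
     (if \<kappa> > 0 then sphere 0 1
      else if \<kappa> = 0 then {u. u $ 3 = 0}
      else {u. lorentz u u = -1 \<and> u $ 3 > 0})"

definition model_dist :: "real \<Rightarrow> real^3 \<Rightarrow> real^3 \<Rightarrow> real" where
  "model_dist \<kappa> u v =
     (if \<kappa> > 0 then arccos (u \<bullet> v) / sqrt \<kappa>
      else if \<kappa> = 0 then dist u v
      else arcosh (- lorentz u v) / sqrt (- \<kappa>))"

definition geodesic_triangle_in ::
  "'a set \<Rightarrow> ('a \<Rightarrow> 'a \<Rightarrow> real) \<Rightarrow> 'a \<Rightarrow> 'a \<Rightarrow> 'a \<Rightarrow> 'a set \<Rightarrow> 'a set \<Rightarrow> 'a set \<Rightarrow> bool" where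
  "geodesic_triangle_in M d p q r P Q R \<longleftrightarrow>
     geodesic_segment_in M d p q P \<and> geodesic_segment_in M d q r Q \<and> geodesic_segment_in M d r p R"

definition comparison_triangle ::
  "real \<Rightarrow> 'a::metric_space \<Rightarrow> 'a \<Rightarrow> 'a \<Rightarrow>
   real^3 \<Rightarrow> real^3 \<Rightarrow> real^3 \<Rightarrow> (real^3) set \<Rightarrow> (real^3) set \<Rightarrow> (real^3) set \<Rightarrow> bool" where
  "comparison_triangle \<kappa> p q r p' q' r' P' Q' R' \<longleftrightarrow>
     geodesic_triangle_in (model_plane \<kappa>) (model_dist \<kappa>) p' q' r' P' Q' R' \<and>
     model_dist \<kappa> p' q' = dist p q \<and> model_dist \<kappa> q' r' = dist q r \<and> model_dist \<kappa> r' p' = dist r p"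

text \<open>Pairs of a point on the side \<open>S\<close> starting at \<open>p\<close> and its comparison point on \<open>S'\<close>.\<close>

definition comparison_points ::
  "real \<Rightarrow> 'a::metric_space \<Rightarrow> 'a set \<Rightarrow> real^3 \<Rightarrow> (real^3) set \<Rightarrow> ('a \<times> (real^3)) set" where
  "comparison_points \<kappa> p S p' S' = {(x, x'). x \<in> S \<and> x' \<in> S' \<and> model_dist \<kappa> p' x' = dist p x}"

text \<open>
  Comparison triangles of perimeter less than \<open>2 D\<^sub>\<kappa>\<close> exist and are unique up to isometry, so
  quantifying over all of them agrees with choosing one.
\<close>

definition CAT_inequality ::
  "real \<Rightarrow> 'a::metric_space \<Rightarrow> 'a \<Rightarrow> 'a \<Rightarrow> 'a set \<Rightarrow> 'a set \<Rightarrow> 'a set \<Rightarrow> bool" where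
  "CAT_inequality \<kappa> p q r P Q R \<longleftrightarrow>
     (\<forall>p' q' r' P' Q' R'. comparison_triangle \<kappa> p q r p' q' r' P' Q' R' \<longrightarrow>
        (let C = comparison_points \<kappa> p P p' P' \<union> comparison_points \<kappa> q Q q' Q'
                 \<union> comparison_points \<kappa> r R r' R'
         in \<forall>(x, x')\<in>C. \<forall>(y, y')\<in>C. dist x y \<le> model_dist \<kappa> x' y'))"

definition CAT_space :: "real \<Rightarrow> 'a::metric_space itself \<Rightarrow> bool" where
  "CAT_space \<kappa> (_ :: 'a itself) \<longleftrightarrow>
     (\<forall>x y :: 'a. ennreal (dist x y) < D_bound \<kappa> \<longrightarrow> (\<exists>S. geodesic_segment x y S)) \<and>
     (\<forall>(p :: 'a) q r P Q R.
        geodesic_triangle_in UNIV dist p q r P Q R \<and>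
        ennreal (dist p q + dist q r + dist r p) < 2 * D_bound \<kappa> \<longrightarrow>
        CAT_inequality \<kappa> p q r P Q R)"

definition D_convex :: "real \<Rightarrow> 'a::metric_space set \<Rightarrow> bool" where
  "D_convex \<kappa> A \<longleftrightarrow>
     (\<forall>a\<in>A. \<forall>b\<in>A. ennreal (dist a b) < D_bound \<kappa> \<longrightarrow>
        (\<exists>S. geodesic_segment a b S) \<and> (\<forall>S. geodesic_segment a b S \<longrightarrow> S \<subseteq> A))"

definition locally_convex_at :: "'a::metric_space set \<Rightarrow> 'a \<Rightarrow> bool" where
  "locally_convex_at A a \<longleftrightarrow>
     (\<exists>\<epsilon>>0. \<forall>x\<in>A \<inter> ball a \<epsilon>. \<forall>y\<in>A \<inter> ball a \<epsilon>.
        (\<exists>S. geodesic_segment x y S \<and> S \<subseteq> ball a \<epsilon>) \<and>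
        (\<forall>S. geodesic_segment x y S \<and> S \<subseteq> ball a \<epsilon> \<longrightarrow> S \<subseteq> A))"

definition locally_convex :: "'a::metric_space set \<Rightarrow> bool" where
  "locally_convex A \<longleftrightarrow> (\<forall>a\<in>A. locally_convex_at A a)"

definition path_length :: "(real \<Rightarrow> 'a::metric_space) \<Rightarrow> ennreal" where
  "path_length \<gamma> =
     (SUP ts \<in> {ts. sorted ts \<and> set ts \<subseteq> {0..1}}.
        \<Sum>i<length ts - 1. ennreal (dist (\<gamma> (ts ! i)) (\<gamma> (ts ! Suc i))))"

definition rectifiable :: "(real \<Rightarrow> 'a::metric_space) \<Rightarrow> bool" where
  "rectifiable \<gamma> \<longleftrightarrow> path_length \<gamma> < \<infinity>"

text \<open>The infimum of the empty set is \<open>\<infinity>\<close> in \<^typ>\<open>ennreal\<close>.\<close>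

definition length_metric :: "'a::metric_space set \<Rightarrow> 'a \<Rightarrow> 'a \<Rightarrow> ennreal" where
  "length_metric A a b =
     (INF \<gamma> \<in> {\<gamma>. path \<gamma> \<and> rectifiable \<gamma> \<and> path_image \<gamma> \<subseteq> A \<and>
                    pathstart \<gamma> = a \<and> pathfinish \<gamma> = b}. path_length \<gamma>)"

definition length_diameter :: "'a::metric_space set \<Rightarrow> ennreal" where
  "length_diameter A = (SUP a\<in>A. SUP b\<in>A. length_metric A a b)"

end

theory Submission
  imports Defs
begin

text \<open>
  Along a path of points \<open>x\<close> of \<open>A\<close> at distance less than \<open>D\<^sub>\<kappa>\<close> from a fixed \<open>a \<in> A\<close>, the
  condition that geodesics from \<open>a\<close> to \<open>x\<close> lie in \<open>A\<close> is open and closed. It is closed because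
  geodesics depend continuously on their endpoints. For openness, a geodesic from \<open>a\<close> to a point
  \<open>x'\<close> of \<open>A\<close> near \<open>x\<close> stays close to the geodesic from \<open>a\<close> to \<open>x\<close>, along which \<open>A\<close> is uniformly
  locally convex. Hence its distance \<open>f\<close> to \<open>A\<close> satisfies, on short pieces, an inequality of the
  type \<open>f'' + \<kappa> f \<ge> 0\<close> with zero boundary values on an interval of length less than \<open>D\<^sub>\<kappa>\<close>, so
  \<open>f = 0\<close> by comparison with a sine function.

  For \<open>\<kappa> > 0\<close> the path joining \<open>a\<close> to \<open>b\<close> is chosen in \<open>A\<close> with length less than
  \<open>2 D\<^sub>\<kappa> - d(a,b)\<close>: a point on it at distance at least \<open>D\<^sub>\<kappa>\<close> from \<open>a\<close> would have distance less than
  \<open>D\<^sub>\<kappa> - d(a,b)\<close> from \<open>b\<close>, contradicting the triangle inequality.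
\<close>

subsection \<open>Generalised sine and cosine\<close>

text \<open>The functions are not normalised by \<open>1 / sqrt \<bar>\<kappa>\<bar>\<close>; the haversine law is homogeneous.
  The frequency is \<open>\<pi> / D\<^sub>\<kappa>\<close>, so that \<open>freq \<kappa> * d < pi\<close> expresses \<open>d < D\<^sub>\<kappa>\<close> for all \<open>\<kappa>\<close>.\<close>

definition sn :: "real \<Rightarrow> real \<Rightarrow> real" where
  "sn \<kappa> x = (if \<kappa> > 0 then sin (sqrt \<kappa> * x) else if \<kappa> = 0 then x else sinh (sqrt (- \<kappa>) * x))"

definition cs :: "real \<Rightarrow> real \<Rightarrow> real" where
  "cs \<kappa> x = (if \<kappa> > 0 then cos (sqrt \<kappa> * x) else if \<kappa> = 0 then 1 else cosh (sqrt (- \<kappa>) * x))"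

definition freq :: "real \<Rightarrow> real" where
  "freq \<kappa> = sqrt (max \<kappa> 0)"

lemma freq_nonneg [simp]: "0 \<le> freq \<kappa>"
  by (simp add: freq_def)

lemma freq_pos: "\<kappa> > 0 \<Longrightarrow> freq \<kappa> = sqrt \<kappa>" and freq_nonpos: "\<kappa> \<le> 0 \<Longrightarrow> freq \<kappa> = 0"
  by (simp_all add: freq_def)

lemma less_D_bound_iff:
  assumes "0 \<le> d"
  shows "ennreal d < D_bound \<kappa> \<longleftrightarrow> freq \<kappa> * d < pi"
proof (cases "\<kappa> > 0")
  case True
  then show ?thesis
    using assms by (simp add: D_bound_def freq_pos ennreal_less_iff field_simps)
qed (simp add: D_bound_def freq_nonpos)

lemma less_double_D_bound_iff:
  assumes "0 \<le> d"
  shows "ennreal d < 2 * D_bound \<kappa> \<longleftrightarrow> freq \<kappa> * d < 2 * pi"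
proof (cases "\<kappa> > 0")
  case True
  have "2 * ennreal (pi / sqrt \<kappa>) = ennreal (2 * (pi / sqrt \<kappa>))"
    using True by (subst ennreal_mult) auto
  then show ?thesis
    using True assms by (simp add: D_bound_def freq_pos ennreal_less_iff field_simps)
qed (simp add: D_bound_def freq_nonpos ennreal_mult_top)

lemma sn_0 [simp]: "sn \<kappa> 0 = 0"
  by (simp add: sn_def)

lemma sn_minus: "sn \<kappa> (- x) = - sn \<kappa> x"
  by (simp add: sn_def)

lemma sn_double: "sn \<kappa> (2 * x) = 2 * sn \<kappa> x * cs \<kappa> x"
  using sin_double[of "sqrt \<kappa> * x"] sinh_double[of "sqrt (- \<kappa>) * x"]
  by (simp add: sn_def cs_def mult.left_commute)

lemma sn_nonneg:
  assumes "0 \<le> x" "freq \<kappa> * x \<le> pi"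
  shows "0 \<le> sn \<kappa> x"
  using assms by (auto simp: sn_def freq_pos intro!: sin_ge_zero)

lemma sn_pos:
  assumes "0 < x" "freq \<kappa> * x < pi"
  shows "0 < sn \<kappa> x"
  using assms by (auto simp: sn_def freq_pos intro!: sin_gt_zero)

lemma sn_strict_mono:
  assumes "0 \<le> x" "x < y" "freq \<kappa> * y \<le> pi / 2"
  shows "sn \<kappa> x < sn \<kappa> y"
proof -
  have "sin (sqrt \<kappa> * x) < sin (sqrt \<kappa> * y)" if "\<kappa> > 0"
  proof (rule sin_monotone_2pi)
    have "0 \<le> sqrt \<kappa> * x" using that assms by simp
    then show "- (pi / 2) \<le> sqrt \<kappa> * x" using pi_half_gt_zero by linarith
  qed (use that assms in \<open>auto simp: freq_pos\<close>)
  then show ?thesis using assms by (simp add: sn_def)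
qed

lemma sn_mono:
  assumes "0 \<le> x" "x \<le> y" "freq \<kappa> * y \<le> pi / 2"
  shows "sn \<kappa> x \<le> sn \<kappa> y"
  using sn_strict_mono[of x y \<kappa>] assms by (cases "x = y") auto

text \<open>The common form of
  \<open>sin\<^sup>2 a - sin\<^sup>2 b = sin (a + b) sin (a - b)\<close>, its hyperbolic analogue
  and the factorisation of a difference of squares. It turns conditions on haversines into
  conditions on the signs of sums and differences of side lengths.\<close>

lemma sn_sq_diff: "(sn \<kappa> x)\<^sup>2 - (sn \<kappa> y)\<^sup>2 = sn \<kappa> (x + y) * sn \<kappa> (x - y)"
proof -
  have "sin (a + b) * sin (a - b) = (sin a)\<^sup>2 - (sin b)\<^sup>2" for a b :: real
  proof -
    have "sin (a + b) * sin (a - b) = (sin a)\<^sup>2 * (cos b)\<^sup>2 - (cos a)\<^sup>2 * (sin b)\<^sup>2"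
      by (simp add: sin_add sin_diff algebra_simps power2_eq_square)
    then show ?thesis by (simp add: cos_squared_eq algebra_simps)
  qed
  moreover have "sinh (a + b) * sinh (a - b) = (sinh a)\<^sup>2 - (sinh b)\<^sup>2" for a b :: real
  proof -
    have "sinh (a + b) * sinh (a - b) = (sinh a)\<^sup>2 * (cosh b)\<^sup>2 - (cosh a)\<^sup>2 * (sinh b)\<^sup>2"
      by (simp add: sinh_add sinh_diff algebra_simps power2_eq_square)
    then show ?thesis by (simp add: cosh_square_eq algebra_simps)
  qed
  ultimately show ?thesis
    by (simp add: sn_def algebra_simps power2_eq_square)
qed

text \<open>Since \<open>sn\<close> increases strictly on the first half of
  \<open>[0, D\<^sub>\<kappa>]\<close>, a haversine determines the distance. This recovers model
  distances from the haversine law.\<close>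

lemma sn_half_sq_cancel:
  assumes "(sn \<kappa> (x / 2))\<^sup>2 = (sn \<kappa> (y / 2))\<^sup>2" "0 \<le> x" "0 \<le> y" "freq \<kappa> * x \<le> pi" "freq \<kappa> * y \<le> pi"
  shows "x = y"
proof -
  have le: "\<not> u < v" if "(sn \<kappa> (u / 2))\<^sup>2 = (sn \<kappa> (v / 2))\<^sup>2" "0 \<le> u" "freq \<kappa> * v \<le> pi" for u v
  proof
    assume "u < v"
    then have "sn \<kappa> (u / 2) < sn \<kappa> (v / 2)" "0 \<le> sn \<kappa> (u / 2)"
      using that mult_left_mono[of u v "freq \<kappa>"] pi_gt_zero
      by (auto intro!: sn_strict_mono sn_nonneg simp del: pi_gt_zero)
    then have "(sn \<kappa> (u / 2))\<^sup>2 < (sn \<kappa> (v / 2))\<^sup>2"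
      by (intro power_strict_mono) auto
    with that show False by simp
  qed
  show ?thesis using le[of x y] le[of y x] assms by auto
qed

subsection \<open>Polar coordinates in the model planes\<close>

text \<open>Geodesic polar coordinates about the pole. The third coordinate is set to 0 separately
  for \<kappa> = 0, because \<open>cs 0 t = 1\<close> would leave the plane
  \<open>u $ 3 = 0\<close>.\<close>

definition polar :: "real \<Rightarrow> real \<Rightarrow> real \<Rightarrow> real^3" where
  "polar \<kappa> \<alpha> t = vector [sn \<kappa> t * cos \<alpha>, sn \<kappa> t * sin \<alpha>, if \<kappa> = 0 then 0 else cs \<kappa> t]"

lemma inner_real_3: "(u :: real^3) \<bullet> v = u $ 1 * v $ 1 + u $ 2 * v $ 2 + u $ 3 * v $ 3"
  by (simp add: inner_vec_def sum_3)

lemma cs_sq_plus_sn_sq: "\<kappa> > 0 \<Longrightarrow> (cs \<kappa> t)\<^sup>2 + (sn \<kappa> t)\<^sup>2 = 1"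
  by (simp add: cs_def sn_def)

lemma cs_sq_minus_sn_sq: "\<kappa> < 0 \<Longrightarrow> (cs \<kappa> t)\<^sup>2 - (sn \<kappa> t)\<^sup>2 = 1"
  by (simp add: cs_def sn_def cosh_square_eq)

lemma polar_in_model_plane: "polar \<kappa> \<alpha> t \<in> model_plane \<kappa>"
proof -
  have id: "(x * cos \<alpha>)\<^sup>2 + (x * sin \<alpha>)\<^sup>2 = x\<^sup>2" for x :: real
    by (simp add: power_mult_distrib flip: distrib_left)
  consider "\<kappa> > 0" | "\<kappa> = 0" | "\<kappa> < 0" by linarith
  then show ?thesis
  proof cases
    case 1
    then have "polar \<kappa> \<alpha> t \<bullet> polar \<kappa> \<alpha> t = 1"
      using id[of "sn \<kappa> t"] cs_sq_plus_sn_sq[of \<kappa> t]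
      by (simp add: polar_def inner_real_3 flip: power2_eq_square)
    then show ?thesis using 1 by (simp add: model_plane_def norm_eq_1)
  next
    case 3
    have "lorentz (polar \<kappa> \<alpha> t) (polar \<kappa> \<alpha> t) = -1"
      using 3 id[of "sn \<kappa> t"] cs_sq_minus_sn_sq[of \<kappa> t]
      by (simp add: polar_def lorentz_def flip: power2_eq_square)
    then show ?thesis using 3 by (simp add: model_plane_def polar_def cs_def)
  qed (simp add: model_plane_def polar_def)
qed

text \<open>The law of cosines for two radii with angle \<open>\<alpha> - \<beta>\<close> at the
  pole. A version in terms of \<open>cs\<close> would be vacuous for \<kappa> = 0, where
  \<open>cs\<close> is constant; half-angle formulas put all three curvatures into one
  shape.\<close>

lemma haversine_law:
  fixes s t \<alpha> \<beta> \<kappa> :: real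
  assumes "0 \<le> s" "0 \<le> t"
  defines "\<delta> \<equiv> model_dist \<kappa> (polar \<kappa> \<alpha> s) (polar \<kappa> \<beta> t)"
  shows "0 \<le> \<delta>" and "freq \<kappa> * \<delta> \<le> pi"
    and "(sn \<kappa> (\<delta> / 2))\<^sup>2 = (sn \<kappa> ((s - t) / 2))\<^sup>2 + sn \<kappa> s * sn \<kappa> t * (sin ((\<alpha> - \<beta>) / 2))\<^sup>2"
proof -
  have hav: "(sin (x / 2))\<^sup>2 = (1 - cos x) / 2" for x :: real
    using cos_double_sin[of "x/2"] by simp
  have havh: "(sinh (x / 2))\<^sup>2 = (cosh x - 1) / 2" for x :: real
    using cosh_double[of "x/2"] cosh_square_eq[of "x/2"] by simp
  consider "\<kappa> > 0" | "\<kappa> = 0" | "\<kappa> < 0" by linarith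
  then have "0 \<le> \<delta> \<and> freq \<kappa> * \<delta> \<le> pi \<and>
    (sn \<kappa> (\<delta> / 2))\<^sup>2 = (sn \<kappa> ((s - t) / 2))\<^sup>2 + sn \<kappa> s * sn \<kappa> t * (sin ((\<alpha> - \<beta>) / 2))\<^sup>2"
  proof cases
    case 1
    define x where "x = polar \<kappa> \<alpha> s \<bullet> polar \<kappa> \<beta> t"
    have "norm (polar \<kappa> \<alpha> s) = 1" "norm (polar \<kappa> \<beta> t) = 1"
      using polar_in_model_plane[of \<kappa> \<alpha> s] polar_in_model_plane[of \<kappa> \<beta> t] 1
      by (auto simp: model_plane_def)
    then have x1: "\<bar>x\<bar> \<le> 1"
      using Cauchy_Schwarz_ineq2[of "polar \<kappa> \<alpha> s" "polar \<kappa> \<beta> t"] by (simp add: x_def)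
    have xe: "x = cos (sqrt \<kappa> * (s - t)) - sn \<kappa> s * sn \<kappa> t * (1 - cos (\<alpha> - \<beta>))"
      using 1 by (simp add: x_def polar_def inner_real_3 cs_def sn_def cos_diff right_diff_distrib
          algebra_simps)
    have d: "sqrt \<kappa> * \<delta> = arccos x"
      using 1 by (simp add: \<delta>_def model_dist_def x_def)
    then have "\<delta> = arccos x / sqrt \<kappa>" using 1 by (simp add: field_simps)
    then have "0 \<le> \<delta>" using 1 x1 by (simp add: arccos_lbound)
    moreover have "freq \<kappa> * \<delta> \<le> pi" using 1 d x1 by (simp add: freq_pos arccos_ubound)
    moreover have "(sn \<kappa> (\<delta> / 2))\<^sup>2 = (1 - x) / 2"
      using 1 d x1 hav[of "sqrt \<kappa> * \<delta>"] by (simp add: sn_def cos_arccos_abs)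
    moreover have "(sn \<kappa> ((s - t) / 2))\<^sup>2 = (1 - cos (sqrt \<kappa> * (s - t))) / 2"
      using 1 hav[of "sqrt \<kappa> * (s - t)"] by (simp add: sn_def)
    moreover have "(1 - x) / 2 = (1 - cos (sqrt \<kappa> * (s - t))) / 2
        + sn \<kappa> s * sn \<kappa> t * ((1 - cos (\<alpha> - \<beta>)) / 2)"
      unfolding xe by algebra
    ultimately show ?thesis
      by (simp only: hav)
  next
    case 2
    have "\<delta>\<^sup>2 = (s * cos \<alpha> - t * cos \<beta>)\<^sup>2 + (s * sin \<alpha> - t * sin \<beta>)\<^sup>2"
      using 2 by (simp add: \<delta>_def model_dist_def dist_norm power2_norm_eq_inner inner_real_3 polar_def
          sn_def flip: power2_eq_square)
    also have "\<dots> = s\<^sup>2 * ((sin \<alpha>)\<^sup>2 + (cos \<alpha>)\<^sup>2) + t\<^sup>2 * ((sin \<beta>)\<^sup>2 + (cos \<beta>)\<^sup>2)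
        - 2 * s * t * cos (\<alpha> - \<beta>)"
      by (simp only: cos_diff) algebra
    also have "\<dots> = (s - t)\<^sup>2 + 4 * s * t * (sin ((\<alpha> - \<beta>) / 2))\<^sup>2"
      unfolding hav by (simp add: power2_eq_square field_simps)
    finally have "(\<delta> / 2)\<^sup>2 = ((s - t) / 2)\<^sup>2 + s * t * (sin ((\<alpha> - \<beta>) / 2))\<^sup>2"
      by (simp add: power_divide)
    then show ?thesis using 2 by (simp add: sn_def freq_def \<delta>_def model_dist_def)
  next
    case 3
    define y where "y = - lorentz (polar \<kappa> \<alpha> s) (polar \<kappa> \<beta> t)"
    have ye: "y = cosh (sqrt (-\<kappa>) * (s - t)) + sn \<kappa> s * sn \<kappa> t * (1 - cos (\<alpha> - \<beta>))"
      using 3 by (simp add: y_def polar_def lorentz_def cs_def sn_def cos_diff right_diff_distrib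
          cosh_diff algebra_simps)
    \<comment> \<open>This sign keeps \<open>y\<close> in the range \<open>y \<ge> 1\<close> on
      which \<open>arcosh\<close> inverts \<open>cosh\<close>.\<close>
    have "0 \<le> sn \<kappa> s * sn \<kappa> t * (1 - cos (\<alpha> - \<beta>))"
      using assms 3 by (intro mult_nonneg_nonneg sn_nonneg) (auto simp: freq_nonpos)
    then have y1: "1 \<le> y"
      using ye cosh_real_ge_1[of "sqrt (-\<kappa>) * (s - t)"] by linarith
    have d: "sqrt (-\<kappa>) * \<delta> = arcosh y"
      using 3 by (simp add: \<delta>_def model_dist_def y_def)
    then have "\<delta> = arcosh y / sqrt (-\<kappa>)" using 3 by (simp add: field_simps)
    then have "0 \<le> \<delta>" using 3 y1 by simp
    moreover have "(sn \<kappa> (\<delta> / 2))\<^sup>2 = (y - 1) / 2"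
      using 3 d y1 havh[of "sqrt (-\<kappa>) * \<delta>"] by (simp add: sn_def cosh_arcosh_real)
    moreover have "(sn \<kappa> ((s - t) / 2))\<^sup>2 = (cosh (sqrt (-\<kappa>) * (s - t)) - 1) / 2"
      using 3 havh[of "sqrt (-\<kappa>) * (s - t)"] by (simp add: sn_def)
    moreover have "(y - 1) / 2 = (cosh (sqrt (-\<kappa>) * (s - t)) - 1) / 2
        + sn \<kappa> s * sn \<kappa> t * ((1 - cos (\<alpha> - \<beta>)) / 2)"
      unfolding ye by algebra
    ultimately show ?thesis
      using 3 by (simp add: hav freq_nonpos)
  qed
  then show "0 \<le> \<delta>" "freq \<kappa> * \<delta> \<le> pi"
    "(sn \<kappa> (\<delta> / 2))\<^sup>2 = (sn \<kappa> ((s - t) / 2))\<^sup>2 + sn \<kappa> s * sn \<kappa> t * (sin ((\<alpha> - \<beta>) / 2))\<^sup>2"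
    by auto
qed

text \<open>For equal angles the angular term of \<open>haversine_law\<close> vanishes, so rays from
  the pole have unit speed.\<close>

lemma model_dist_polar_same:
  assumes "0 \<le> s" "0 \<le> t" "freq \<kappa> * \<bar>s - t\<bar> \<le> pi"
  shows "model_dist \<kappa> (polar \<kappa> \<alpha> s) (polar \<kappa> \<alpha> t) = \<bar>s - t\<bar>"
proof (rule sn_half_sq_cancel)
  have "(sn \<kappa> (\<bar>s - t\<bar> / 2))\<^sup>2 = (sn \<kappa> ((s - t) / 2))\<^sup>2"
  proof (cases "s \<le> t")
    case True
    then have "sn \<kappa> (\<bar>s - t\<bar> / 2) = - sn \<kappa> ((s - t) / 2)"
      using sn_minus[of \<kappa> "(s - t) / 2"] by (simp only: minus_divide_left) simp
    then show ?thesis by simp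
  qed simp
  then show "(sn \<kappa> (model_dist \<kappa> (polar \<kappa> \<alpha> s) (polar \<kappa> \<alpha> t) / 2))\<^sup>2 = (sn \<kappa> (\<bar>s - t\<bar> / 2))\<^sup>2"
    using haversine_law(3)[OF assms(1,2), of \<kappa> \<alpha> \<alpha>] by simp
qed (use haversine_law(1,2)[OF assms(1,2)] assms in auto)

section \<open>Geodesics and comparison triangles in the model planes\<close>

lemma geodesic_segment_in_iff:
  "geodesic_segment_in M d x y S \<longleftrightarrow>
    (\<exists>c L. 0 \<le> L \<and> c ` {0..L} \<subseteq> M \<and> (\<forall>s\<in>{0..L}. \<forall>t\<in>{0..L}. d (c s) (c t) = \<bar>s - t\<bar>) \<and>
      c 0 = x \<and> c L = y \<and> S = c ` {0..L})"
proof
  assume "geodesic_segment_in M d x y S"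
  then obtain a b c where c: "a \<le> b" "c ` {a..b} \<subseteq> M"
    "\<forall>s\<in>{a..b}. \<forall>t\<in>{a..b}. d (c s) (c t) = \<bar>s - t\<bar>" "c a = x" "c b = y" "S = c ` {a..b}"
    unfolding geodesic_segment_in_def by blast
  have "(\<lambda>t. c (a + t)) ` {0..b - a} = c ` {a..b}"
    using image_image[of c "(+) a" "{0..b - a}"] by (simp add: add.commute)
  with c show "\<exists>c L. 0 \<le> L \<and> c ` {0..L} \<subseteq> M \<and>
      (\<forall>s\<in>{0..L}. \<forall>t\<in>{0..L}. d (c s) (c t) = \<bar>s - t\<bar>) \<and> c 0 = x \<and> c L = y \<and> S = c ` {0..L}"
    by (intro exI[of _ "\<lambda>t. c (a + t)"] exI[of _ "b - a"]) auto
next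
  assume "\<exists>c L. 0 \<le> L \<and> c ` {0..L} \<subseteq> M \<and>
      (\<forall>s\<in>{0..L}. \<forall>t\<in>{0..L}. d (c s) (c t) = \<bar>s - t\<bar>) \<and> c 0 = x \<and> c L = y \<and> S = c ` {0..L}"
  then show "geodesic_segment_in M d x y S"
    unfolding geodesic_segment_in_def by blast
qed

lemma geodesic_segment_in_sym:
  assumes "geodesic_segment_in M d x y S"
  shows "geodesic_segment_in M d y x S"
proof -
  obtain a b c where c: "a \<le> b" "c ` {a..b} \<subseteq> M"
    "\<forall>s\<in>{a..b}. \<forall>t\<in>{a..b}. d (c s) (c t) = \<bar>s - t\<bar>" "c a = x" "c b = y" "S = c ` {a..b}"
    using assms unfolding geodesic_segment_in_def by blast
  have "(\<lambda>t. c (- t)) ` {-b..-a} = c ` {a..b}"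
    using image_image[of c uminus "{-b..-a}"] by simp
  with c show ?thesis
    unfolding geodesic_segment_in_def
    by (intro exI[of _ "-b"] exI[of _ "-a"] exI[of _ "\<lambda>t. c (- t)"]) auto
qed

lemma polar_geodesic:
  assumes "0 \<le> L" "freq \<kappa> * L \<le> pi"
  shows "geodesic_segment_in (model_plane \<kappa>) (model_dist \<kappa>) (polar \<kappa> \<alpha> 0) (polar \<kappa> \<alpha> L)
           (polar \<kappa> \<alpha> ` {0..L})"
  unfolding geodesic_segment_in_iff
proof (intro exI[of _ "polar \<kappa> \<alpha>"] exI[of _ L] conjI ballI)
  fix s t assume st: "s \<in> {0..L}" "t \<in> {0..L}"
  then have "freq \<kappa> * \<bar>s - t\<bar> \<le> freq \<kappa> * L"
    by (intro mult_left_mono) auto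
  with st assms show "model_dist \<kappa> (polar \<kappa> \<alpha> s) (polar \<kappa> \<alpha> t) = \<bar>s - t\<bar>"
    by (intro model_dist_polar_same) auto
qed (use assms polar_in_model_plane in auto)

text \<open>The geodesic is the spherical linear interpolation \<open>(sn (D - t) u + sn t v) / sn D\<close>, whose
  formula is the same for all signs of the curvature.\<close>

lemma model_geodesic_exists:
  fixes u v :: "real^3" and \<kappa> :: real
  defines "D \<equiv> model_dist \<kappa> u v"
  assumes uv: "u \<in> model_plane \<kappa>" "v \<in> model_plane \<kappa>" and D: "0 < D" "freq \<kappa> * D < pi"
  shows "\<exists>S. geodesic_segment_in (model_plane \<kappa>) (model_dist \<kappa>) u v S"
proof -
  define \<gamma> where "\<gamma> t = (1 / sn \<kappa> D) *\<^sub>R (sn \<kappa> (D - t) *\<^sub>R u + sn \<kappa> t *\<^sub>R v)" for t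
  have snD: "sn \<kappa> D > 0" using D by (rule sn_pos)
  have ends: "\<gamma> 0 = u" "\<gamma> D = v" using snD by (auto simp: \<gamma>_def)
  have "\<gamma> t \<in> model_plane \<kappa> \<and> model_dist \<kappa> (\<gamma> s) (\<gamma> t) = \<bar>s - t\<bar>"
    if st: "s \<in> {0..D}" "t \<in> {0..D}" for s t
  proof -
    have pos: "0 \<le> sn \<kappa> t" "0 \<le> sn \<kappa> (D - t)"
      using st D mult_left_mono[of t D "freq \<kappa>"] mult_left_mono[of "D - t" D "freq \<kappa>"]
      by (auto intro!: sn_nonneg)
    consider "\<kappa> > 0" | "\<kappa> = 0" | "\<kappa> < 0" by linarith
    then show ?thesis
    proof cases
      case 1
      have nrm: "u \<bullet> u = 1" "v \<bullet> v = 1" using uv 1 by (auto simp: model_plane_def dot_square_norm)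
      then have abs1: "\<bar>u \<bullet> v\<bar> \<le> 1"
        using Cauchy_Schwarz_ineq2[of u v] by (simp add: norm_eq_sqrt_inner)
      have "sqrt \<kappa> * D = arccos (u \<bullet> v)" using 1 by (simp add: D_def model_dist_def)
      then have uvD: "u \<bullet> v = cos (sqrt \<kappa> * D)" using abs1 by (simp add: cos_arccos_abs)
      \<comment> \<open>Evaluates the bilinear expansion of
        \<open>\<gamma> s \<bullet> \<gamma> t\<close>; the hyperbolic case below has the same
        shape.\<close>
      have id: "sin (d - a) * sin (d - b) + sin a * sin b
          + (sin (d - a) * sin b + sin a * sin (d - b)) * cos d = (sin d)\<^sup>2 * cos (a - b)"
        for a b d :: real
      proof -
        have "(sin d)\<^sup>2 + (cos d)\<^sup>2 = 1" by simp
        then show ?thesis unfolding sin_diff cos_diff by algebra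
      qed
      have inn: "\<gamma> s \<bullet> \<gamma> t = cos (sqrt \<kappa> * (s - t))" for s t
      proof -
        have "\<gamma> s \<bullet> \<gamma> t = (sn \<kappa> (D - s) * sn \<kappa> (D - t) + sn \<kappa> s * sn \<kappa> t
            + (sn \<kappa> (D - s) * sn \<kappa> t + sn \<kappa> s * sn \<kappa> (D - t)) * cos (sqrt \<kappa> * D)) / (sn \<kappa> D)\<^sup>2"
          by (simp add: \<gamma>_def inner_add_left inner_add_right nrm uvD inner_commute[of v u]
              power2_eq_square algebra_simps add_divide_distrib)
        also have "\<dots> = cos (sqrt \<kappa> * (s - t))"
          using 1 snD id[of "sqrt \<kappa> * D" "sqrt \<kappa> * s" "sqrt \<kappa> * t"]
          by (simp add: sn_def right_diff_distrib)
        finally show ?thesis .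
      qed
      have "\<bar>sqrt \<kappa> * (s - t)\<bar> \<le> pi"
      proof -
        have "\<bar>sqrt \<kappa> * (s - t)\<bar> \<le> sqrt \<kappa> * D"
          using st 1 by (auto simp: abs_mult intro!: mult_left_mono)
        then show ?thesis using D 1 by (simp add: freq_pos)
      qed
      then have "arccos (cos (sqrt \<kappa> * (s - t))) = \<bar>sqrt \<kappa> * (s - t)\<bar>"
        using arccos_cos[of "\<bar>sqrt \<kappa> * (s - t)\<bar>"] by (simp add: cos_abs_real)
      then show ?thesis
        using 1 inn[of t t] by (simp add: model_plane_def model_dist_def inn norm_eq_1 abs_mult)
    next
      case 2
      have D2: "D = dist u v" using 2 by (simp add: D_def model_dist_def)
      have \<gamma>2: "\<gamma> t = u + (t / D) *\<^sub>R (v - u)" for t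
        using 2 D by (simp add: \<gamma>_def sn_def algebra_simps divide_simps)
      have "\<gamma> s - \<gamma> t = ((s - t) / D) *\<^sub>R (v - u)"
        by (simp add: \<gamma>2 algebra_simps diff_divide_distrib)
      then have "dist (\<gamma> s) (\<gamma> t) = \<bar>s - t\<bar>"
        using D D2 by (simp add: dist_norm abs_mult norm_minus_commute)
      then show ?thesis
        using 2 uv by (simp add: model_plane_def model_dist_def \<gamma>2)
    next
      case 3
      have nrm: "lorentz u u = -1" "lorentz v v = -1" and u3: "u $ 3 > 0" "v $ 3 > 0"
        using uv 3 by (auto simp: model_plane_def)
      have y1: "1 \<le> - lorentz u v"
      proof -
        \<comment> \<open>The reversed Cauchy-Schwarz inequality: Lagrange's identity for the
          vectors \<open>(1, u $ 1, u $ 2)\<close> and \<open>(1, v $ 1, v $ 2)\<close>, whose norms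
          are \<open>u $ 3\<close> and \<open>v $ 3\<close> on the hyperboloid.\<close>
        have "u $ 3 * v $ 3 \<ge> 1 + u $ 1 * v $ 1 + u $ 2 * v $ 2"
        proof (rule power2_le_imp_le)
          have "(u $ 3 * v $ 3)\<^sup>2 - (1 + u $ 1 * v $ 1 + u $ 2 * v $ 2)\<^sup>2
            = (u $ 1 - v $ 1)\<^sup>2 + (u $ 2 - v $ 2)\<^sup>2 + (u $ 1 * v $ 2 - u $ 2 * v $ 1)\<^sup>2"
            using nrm unfolding lorentz_def by algebra
          also have "\<dots> \<ge> 0" by simp
          finally show "(1 + u $ 1 * v $ 1 + u $ 2 * v $ 2)\<^sup>2 \<le> (u $ 3 * v $ 3)\<^sup>2" by simp
        qed (use u3 in auto)
        then show ?thesis by (simp add: lorentz_def)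
      qed
      have "sqrt (-\<kappa>) * D = arcosh (- lorentz u v)" using 3 by (simp add: D_def model_dist_def)
      then have uvD: "lorentz u v = - cosh (sqrt (-\<kappa>) * D)" using y1 by simp
      have id: "sinh (d - a) * sinh (d - b) + sinh a * sinh b
          + (sinh (d - a) * sinh b + sinh a * sinh (d - b)) * cosh d = (sinh d)\<^sup>2 * cosh (a - b)"
        for a b d :: real
      proof -
        have "(cosh d)\<^sup>2 = (sinh d)\<^sup>2 + 1" by (rule cosh_square_eq)
        then show ?thesis unfolding sinh_diff cosh_diff by algebra
      qed
      have inn: "lorentz (\<gamma> s) (\<gamma> t) = - cosh (sqrt (-\<kappa>) * (s - t))" for s t
      proof -
        have "lorentz (\<gamma> s) (\<gamma> t) = (sn \<kappa> (D - s) * sn \<kappa> (D - t) * lorentz u u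
            + sn \<kappa> s * sn \<kappa> t * lorentz v v
            + (sn \<kappa> (D - s) * sn \<kappa> t + sn \<kappa> s * sn \<kappa> (D - t)) * lorentz u v) / (sn \<kappa> D)\<^sup>2"
          unfolding lorentz_def using snD by (simp add: \<gamma>_def power2_eq_square field_simps)
        also have "\<dots> = - (sn \<kappa> (D - s) * sn \<kappa> (D - t) + sn \<kappa> s * sn \<kappa> t
            + (sn \<kappa> (D - s) * sn \<kappa> t + sn \<kappa> s * sn \<kappa> (D - t)) * cosh (sqrt (-\<kappa>) * D)) / (sn \<kappa> D)\<^sup>2"
          by (simp add: nrm uvD)
        also have "\<dots> = - cosh (sqrt (-\<kappa>) * (s - t))"
          using 3 snD D id[of "sqrt (-\<kappa>) * D" "sqrt (-\<kappa>) * s" "sqrt (-\<kappa>) * t"]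
          by (simp add: sn_def right_diff_distrib)
        finally show ?thesis .
      qed
      \<comment> \<open>The interpolated point stays on the upper sheet. At \<open>t = 0\<close>
        positivity comes from \<open>u\<close>, elsewhere from \<open>v\<close>.\<close>
      have "sn \<kappa> (D - t) * u $ 3 + sn \<kappa> t * v $ 3 > 0"
      proof (cases "t = 0")
        case False
        then have "sn \<kappa> t > 0" using st 3 by (intro sn_pos) (auto simp: freq_nonpos)
        then show ?thesis using pos u3 by (intro add_nonneg_pos) auto
      qed (use snD u3 in auto)
      then have "\<gamma> t $ 3 > 0" using snD by (simp add: \<gamma>_def)
      moreover have "arcosh (cosh (sqrt (-\<kappa>) * (s - t))) = \<bar>sqrt (-\<kappa>) * (s - t)\<bar>"
        using arcosh_cosh_real[of "\<bar>sqrt (-\<kappa>) * (s - t)\<bar>"] by simp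
      ultimately show ?thesis
        using 3 by (simp add: model_plane_def model_dist_def inn abs_mult)
    qed
  qed
  with D ends have "geodesic_segment_in (model_plane \<kappa>) (model_dist \<kappa>) u v (\<gamma> ` {0..D})"
    unfolding geodesic_segment_in_iff by (intro exI[of _ \<gamma>] exI[of _ D]) auto
  then show ?thesis by blast
qed

text \<open>One vertex is placed at the pole, and the haversine law then prescribes
  \<open>sin\<^sup>2 (\<alpha> / 2) = N / P\<close>. This ratio lies in [0, 1] because
  \<open>N\<close> and \<open>P - N\<close> factor by \<open>sn_sq_diff\<close> into values of
  \<open>sn\<close> that are nonnegative by the triangle inequalities and the perimeter
  bound.\<close>

lemma model_triangle_exists:
  fixes L L' D \<kappa> :: real
  assumes nn: "0 \<le> L" "0 \<le> L'" and D: "\<bar>L - L'\<bar> \<le> D" "D \<le> L + L'"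
    and perim: "freq \<kappa> * (L + L' + D) < 2 * pi"
  obtains \<alpha> Q where
    "geodesic_segment_in (model_plane \<kappa>) (model_dist \<kappa>) (polar \<kappa> 0 L) (polar \<kappa> \<alpha> L') Q"
    "model_dist \<kappa> (polar \<kappa> 0 L) (polar \<kappa> \<alpha> L') = D"
    "(sn \<kappa> (D / 2))\<^sup>2 = (sn \<kappa> ((L - L') / 2))\<^sup>2 + sn \<kappa> L * sn \<kappa> L' * (sin (\<alpha> / 2))\<^sup>2"
proof -
  have half: "freq \<kappa> * x < pi" if "2 * x \<le> L + L' + D" for x
    using mult_left_mono[OF that freq_nonneg[of \<kappa>]] perim by simp
  have fL: "freq \<kappa> * L < pi" "freq \<kappa> * L' < pi" "freq \<kappa> * D < pi"
    by (rule half, use D in simp)+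
  have snn: "0 \<le> sn \<kappa> L" "0 \<le> sn \<kappa> L'"
    using nn fL by (auto intro!: sn_nonneg)
  define P where "P = sn \<kappa> L * sn \<kappa> L'"
  define N where "N = (sn \<kappa> (D / 2))\<^sup>2 - (sn \<kappa> ((L - L') / 2))\<^sup>2"
  \<comment> \<open>If \<open>P = 0\<close> then also \<open>N = 0\<close>, and the convention
    \<open>0 / 0 = 0\<close> keeps \<open>N = P * k\<close> valid.\<close>
  define k where "k = N / P"
  have P0: "0 \<le> P" using snn by (simp add: P_def)
  have N: "N = sn \<kappa> ((D + (L - L')) / 2) * sn \<kappa> ((D - (L - L')) / 2)"
    unfolding N_def sn_sq_diff by (simp add: add_divide_distrib diff_divide_distrib)
  have N0: "0 \<le> N"
    unfolding N using D half[of "(D + (L - L')) / 2"] half[of "(D - (L - L')) / 2"] nn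
    by (intro mult_nonneg_nonneg sn_nonneg) auto
  have "P - N = sn \<kappa> ((L + L' + D) / 2) * sn \<kappa> ((L + L' - D) / 2)"
    using sn_sq_diff[of \<kappa> "(L + L') / 2" "(L - L') / 2"] sn_sq_diff[of \<kappa> "(L + L') / 2" "D / 2"]
    by (simp add: P_def N_def add_divide_distrib diff_divide_distrib)
  also have "\<dots> \<ge> 0"
    using D half[of "(L + L' + D) / 2"] half[of "(L + L' - D) / 2"] nn
    by (intro mult_nonneg_nonneg sn_nonneg) auto
  finally have NP: "N \<le> P" by simp
  have k: "0 \<le> k" "k \<le> 1" "N = P * k"
    using P0 N0 NP by (auto simp: k_def divide_le_eq_1)
  define \<alpha> where "\<alpha> = 2 * arcsin (sqrt k)"
  have "sin (\<alpha> / 2) = sqrt k"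
    using k order_trans[of "-1" 0 "sqrt k"] by (simp add: \<alpha>_def)
  then have sin\<alpha>: "(sin (\<alpha> / 2))\<^sup>2 = k" using k by simp
  then have eq: "(sn \<kappa> (D / 2))\<^sup>2 = (sn \<kappa> ((L - L') / 2))\<^sup>2 + sn \<kappa> L * sn \<kappa> L' * (sin (\<alpha> / 2))\<^sup>2"
    using k by (simp add: N_def P_def)
  have md: "model_dist \<kappa> (polar \<kappa> 0 L) (polar \<kappa> \<alpha> L') = D"
  proof (rule sn_half_sq_cancel)
    show "(sn \<kappa> (model_dist \<kappa> (polar \<kappa> 0 L) (polar \<kappa> \<alpha> L') / 2))\<^sup>2 = (sn \<kappa> (D / 2))\<^sup>2"
      using haversine_law(3)[OF nn, of \<kappa> 0 \<alpha>] unfolding eq by simp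
  qed (use haversine_law(1,2)[OF nn, of \<kappa> 0 \<alpha>] fL(3) D in linarith)+
  have "\<exists>Q. geodesic_segment_in (model_plane \<kappa>) (model_dist \<kappa>) (polar \<kappa> 0 L) (polar \<kappa> \<alpha> L') Q"
  \<comment> \<open>The interpolation formula divides by \<open>sn D\<close>, so the degenerate side
    is treated as a constant geodesic.\<close>
  proof (cases "D = 0")
    case True
    then have "L = L'" using D by simp
    moreover from this have "\<alpha> = 0" by (simp add: \<alpha>_def k_def N_def True)
    moreover have "geodesic_segment_in (model_plane \<kappa>) (model_dist \<kappa>) (polar \<kappa> 0 L) (polar \<kappa> 0 L)
        {polar \<kappa> 0 L}"
      unfolding geodesic_segment_in_iff
      using model_dist_polar_same[of L L \<kappa> 0] nn polar_in_model_plane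
      by (intro exI[of _ "\<lambda>_. polar \<kappa> 0 L"] exI[of _ 0]) auto
    ultimately show ?thesis by blast
  next
    case False
    then show ?thesis
      using md fL D polar_in_model_plane by (intro model_geodesic_exists) auto
  qed
  with md eq that show ?thesis by blast
qed

subsection \<open>The haversine comparison in a CAT space\<close>

text \<open>Keeps the unit-speed parametrisation, starting at 0, that
  \<open>geodesic_segment\<close> forgets; values outside \<open>[0, L]\<close> are
  unconstrained.\<close>

definition geodesic_path :: "(real \<Rightarrow> 'a::metric_space) \<Rightarrow> real \<Rightarrow> 'a \<Rightarrow> 'a \<Rightarrow> bool" where
  "geodesic_path c L x y \<longleftrightarrow>
     0 \<le> L \<and> c 0 = x \<and> c L = y \<and> (\<forall>s\<in>{0..L}. \<forall>t\<in>{0..L}. dist (c s) (c t) = \<bar>s - t\<bar>)"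

lemma geodesic_path_length: "geodesic_path c L x y \<Longrightarrow> L = dist x y"
  unfolding geodesic_path_def by force

lemma geodesic_path_segment: "geodesic_path c L x y \<Longrightarrow> geodesic_segment x y (c ` {0..L})"
  unfolding geodesic_segment_in_iff geodesic_path_def by blast

lemma geodesic_segmentE:
  assumes "geodesic_segment x y S"
  obtains c L where "geodesic_path c L x y" "S = c ` {0..L}"
  using assms unfolding geodesic_segment_in_iff geodesic_path_def by blast

lemma geodesic_path_dist:
  "geodesic_path c L x y \<Longrightarrow> s \<in> {0..L} \<Longrightarrow> t \<in> {0..L} \<Longrightarrow> dist (c s) (c t) = \<bar>s - t\<bar>"
  unfolding geodesic_path_def by blast

lemma geodesic_path_ends:
  "geodesic_path c L x y \<Longrightarrow> c 0 = x" "geodesic_path c L x y \<Longrightarrow> c L = y"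
  "geodesic_path c L x y \<Longrightarrow> 0 \<le> L"
  unfolding geodesic_path_def by auto

lemma geodesic_path_reverse:
  "geodesic_path c L x y \<Longrightarrow> geodesic_path (\<lambda>t. c (L - t)) L y x"
  unfolding geodesic_path_def by auto

lemma geodesic_path_subpath:
  "geodesic_path c L x y \<Longrightarrow> 0 \<le> a \<Longrightarrow> a \<le> b \<Longrightarrow> b \<le> L \<Longrightarrow>
    geodesic_path (\<lambda>t. c (a + t)) (b - a) (c a) (c b)"
  unfolding geodesic_path_def by auto

text \<open>The CAT inequality made explicit: in a comparison triangle with \<open>p\<close> at the
  pole, two sides are rays and \<open>haversine_law\<close> computes distances between them. Here
  \<open>k\<close> is the squared sine of half the comparison angle at \<open>p\<close>; since it is
  independent of \<open>s\<close> and \<open>t\<close>, eliminating it bounds distances between the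
  geodesics by \<open>dist q r\<close>.\<close>

lemma haversine_comparison:
  fixes c c' :: "real \<Rightarrow> 'a::metric_space"
  assumes cat: "CAT_space \<kappa> TYPE('a)"
    and c: "geodesic_path c L p q" and c': "geodesic_path c' L' p r"
    and perim: "freq \<kappa> * (L + L' + dist q r) < 2 * pi"
  obtains k where "0 \<le> k"
    "(sn \<kappa> (dist q r / 2))\<^sup>2 = (sn \<kappa> ((L - L') / 2))\<^sup>2 + sn \<kappa> L * sn \<kappa> L' * k"
    "\<And>s t. s \<in> {0..L} \<Longrightarrow> t \<in> {0..L'} \<Longrightarrow>
       (sn \<kappa> (dist (c s) (c' t) / 2))\<^sup>2 \<le> (sn \<kappa> ((s - t) / 2))\<^sup>2 + sn \<kappa> s * sn \<kappa> t * k"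
proof -
  define D where "D = dist q r"
  have L: "L = dist p q" "L' = dist p r" and nn: "0 \<le> L" "0 \<le> L'"
    using geodesic_path_length[OF c] geodesic_path_length[OF c'] by auto
  have D: "\<bar>L - L'\<bar> \<le> D" "D \<le> L + L'"
    unfolding L D_def using dist_triangle[of p q r] dist_triangle[of p r q] dist_triangle[of q r p]
    by (auto simp: dist_commute)
  obtain \<alpha> Q' where Q': "geodesic_segment_in (model_plane \<kappa>) (model_dist \<kappa>) (polar \<kappa> 0 L) (polar \<kappa> \<alpha> L') Q'"
    and md: "model_dist \<kappa> (polar \<kappa> 0 L) (polar \<kappa> \<alpha> L') = D"
    and eq: "(sn \<kappa> (D / 2))\<^sup>2 = (sn \<kappa> ((L - L') / 2))\<^sup>2 + sn \<kappa> L * sn \<kappa> L' * (sin (\<alpha> / 2))\<^sup>2"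
    using model_triangle_exists[OF nn D perim[folded D_def]] by blast
  have half: "freq \<kappa> * x < pi" if "2 * x \<le> L + L' + D" for x
    using mult_left_mono[OF that freq_nonneg[of \<kappa>]] perim by (simp add: D_def)
  have fL: "freq \<kappa> * L < pi" "freq \<kappa> * L' < pi" "freq \<kappa> * D < pi"
    by (rule half, use D in simp)+
  \<comment> \<open>The CAT condition speaks of full triangles, so a third side has to be
    chosen.\<close>
  obtain Q where Q: "geodesic_segment q r Q"
    using cat fL(3) less_D_bound_iff[OF zero_le_dist, of q r \<kappa>] unfolding CAT_space_def D_def by blast
  define P R where "P = c ` {0..L}" and "R = c' ` {0..L'}"
  have tri: "geodesic_triangle_in UNIV dist p q r P Q R"
    unfolding geodesic_triangle_in_def P_def R_def
    using geodesic_path_segment[OF c] geodesic_segment_in_sym[OF geodesic_path_segment[OF c']] Q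
    by simp
  have "ennreal (dist p q + dist q r + dist r p) < 2 * D_bound \<kappa>"
    using perim less_double_D_bound_iff[of "dist p q + dist q r + dist r p" \<kappa>]
    by (simp add: L dist_commute algebra_simps)
  with tri cat have ineq: "CAT_inequality \<kappa> p q r P Q R"
    unfolding CAT_space_def by blast
  define p' q' r' where "p' = polar \<kappa> 0 0" "q' = polar \<kappa> 0 L" "r' = polar \<kappa> \<alpha> L'"
  define P' R' where "P' = polar \<kappa> 0 ` {0..L}" "R' = polar \<kappa> \<alpha> ` {0..L'}"
  have pole: "polar \<kappa> \<alpha> 0 = p'" by (simp add: p'_q'_r'_def polar_def)
  have same: "model_dist \<kappa> (polar \<kappa> \<beta> s) (polar \<kappa> \<beta> t) = \<bar>s - t\<bar>"
    if "s \<in> {0..l}" "t \<in> {0..l}" "l = L \<or> l = L'" for s t l \<beta>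
  proof -
    have "freq \<kappa> * \<bar>s - t\<bar> \<le> freq \<kappa> * l" using that by (intro mult_left_mono) auto
    then show ?thesis using that fL by (intro model_dist_polar_same) auto
  qed
  have sideP: "model_dist \<kappa> p' (polar \<kappa> 0 s) = s" if "s \<in> {0..L}" for s
    using same[of 0 L s 0] that nn by (simp add: p'_q'_r'_def)
  \<comment> \<open>The third side of the triangle runs from \<open>r\<close> to \<open>p\<close>,
    against the direction of \<open>c'\<close>, so its comparison points are measured from
    \<open>r\<close>.\<close>
  have sideR: "model_dist \<kappa> r' (polar \<kappa> \<alpha> t) = L' - t" if "t \<in> {0..L'}" for t
    using same[of L' L' t \<alpha>] that nn by (simp add: p'_q'_r'_def)
  have "comparison_triangle \<kappa> p q r p' q' r' P' Q' R'"
    unfolding comparison_triangle_def geodesic_triangle_in_def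
  proof (intro conjI)
    show "geodesic_segment_in (model_plane \<kappa>) (model_dist \<kappa>) p' q' P'"
      unfolding p'_q'_r'_def P'_R'_def using nn fL by (intro polar_geodesic) auto
    show "geodesic_segment_in (model_plane \<kappa>) (model_dist \<kappa>) q' r' Q'"
      using Q' by (simp add: p'_q'_r'_def)
    show "geodesic_segment_in (model_plane \<kappa>) (model_dist \<kappa>) r' p' R'"
      using geodesic_segment_in_sym[OF polar_geodesic[of L' \<kappa> \<alpha>]] nn fL pole
      by (simp add: p'_q'_r'_def P'_R'_def)
    show "model_dist \<kappa> p' q' = dist p q"
      using sideP[of L] nn L by (simp add: p'_q'_r'_def)
    show "model_dist \<kappa> q' r' = dist q r"
      using md by (simp add: p'_q'_r'_def D_def)
    show "model_dist \<kappa> r' p' = dist r p"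
      using sideR[of 0] nn L pole by (simp add: dist_commute)
  qed
  with ineq have ineq': "dist x y \<le> model_dist \<kappa> x' y'"
    if "(x, x') \<in> comparison_points \<kappa> p P p' P'" "(y, y') \<in> comparison_points \<kappa> r R r' R'" for x x' y y'
    using that unfolding CAT_inequality_def Let_def by blast
  show ?thesis
  proof (rule that)
    show "0 \<le> (sin (\<alpha> / 2))\<^sup>2" by simp
    show "(sn \<kappa> (dist q r / 2))\<^sup>2 = (sn \<kappa> ((L - L') / 2))\<^sup>2 + sn \<kappa> L * sn \<kappa> L' * (sin (\<alpha> / 2))\<^sup>2"
      using eq by (simp add: D_def)
    fix s t assume st: "s \<in> {0..L}" "t \<in> {0..L'}"
    have st0: "0 \<le> s" "0 \<le> t" using st by auto
    define \<delta> where "\<delta> = model_dist \<kappa> (polar \<kappa> 0 s) (polar \<kappa> \<alpha> t)"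
    have "dist (c s) (c' t) \<le> \<delta>"
      unfolding \<delta>_def
    proof (rule ineq')
      show "(c s, polar \<kappa> 0 s) \<in> comparison_points \<kappa> p P p' P'"
        using st sideP geodesic_path_dist[OF c, of 0 s] geodesic_path_ends[OF c]
        by (auto simp: comparison_points_def P_def P'_R'_def)
      show "(c' t, polar \<kappa> \<alpha> t) \<in> comparison_points \<kappa> r R r' R'"
        using st sideR geodesic_path_dist[OF c', of L' t] geodesic_path_ends[OF c']
        by (auto simp: comparison_points_def R_def P'_R'_def)
    qed
    then have "(sn \<kappa> (dist (c s) (c' t) / 2))\<^sup>2 \<le> (sn \<kappa> (\<delta> / 2))\<^sup>2"
      using haversine_law(1,2)[OF st0, of \<kappa> 0 \<alpha>] mult_left_mono[of "dist (c s) (c' t)" \<delta> "freq \<kappa>"]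
      pi_ge_zero
      by (intro power_mono sn_mono sn_nonneg) (auto simp flip: \<delta>_def simp del: pi_ge_zero)
    then show "(sn \<kappa> (dist (c s) (c' t) / 2))\<^sup>2
        \<le> (sn \<kappa> ((s - t) / 2))\<^sup>2 + sn \<kappa> s * sn \<kappa> t * (sin (\<alpha> / 2))\<^sup>2"
      using haversine_law(3)[OF st0, of \<kappa> 0 \<alpha>] by (simp add: \<delta>_def)
  qed
qed

subsection \<open>Stability of geodesics and midpoints\<close>

lemma isCont_sn [continuous_intros]: "isCont f x \<Longrightarrow> isCont (\<lambda>x. sn \<kappa> (f x)) x"
  by (cases "\<kappa> > 0"; cases "\<kappa> = 0") (auto simp: sn_def intro!: continuous_intros)

lemma cs_minus [simp]: "cs \<kappa> (- x) = cs \<kappa> x"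
  by (simp add: cs_def)

text \<open>An equality for \<kappa> > 0; otherwise the left side is 1. Lower bounds on
  \<open>cs\<close> can thus be chosen through the cosine for every \<kappa>.\<close>

lemma cos_freq_le_cs: "cos (freq \<kappa> * x) \<le> cs \<kappa> x"
  using cosh_real_ge_1 by (auto simp: cs_def freq_pos freq_nonpos)

text \<open>\<open>m\<close> is the derivative of \<open>sn\<close> at 0, which differs from 1 in
  general because \<open>sn\<close> is not normalised; it cancels where both bounds are
  combined.\<close>

lemma sn_asymptotically_linear:
  obtains m where "m > 0"
    "\<And>\<eta>. \<eta> > 0 \<Longrightarrow> \<exists>\<rho>>0. \<forall>x\<in>{0..\<rho>}. (1 - \<eta>) * m * x \<le> sn \<kappa> x \<and> sn \<kappa> x \<le> (1 + \<eta>) * m * x"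
proof -
  define m where "m = (if \<kappa> > 0 then sqrt \<kappa> else if \<kappa> = 0 then 1 else sqrt (-\<kappa>))"
  have "m > 0" by (simp add: m_def)
  have "(sn \<kappa> has_real_derivative m) (at 0)"
    unfolding sn_def m_def
    by (cases "\<kappa> > 0"; cases "\<kappa> = 0") (auto intro!: derivative_eq_intros)
  then have lim: "((\<lambda>x. sn \<kappa> x / x) \<longlongrightarrow> m) (at 0)"
    by (simp add: has_field_derivative_iff)
  have "\<exists>\<rho>>0. \<forall>x\<in>{0..\<rho>}. (1 - \<eta>) * m * x \<le> sn \<kappa> x \<and> sn \<kappa> x \<le> (1 + \<eta>) * m * x" if "\<eta> > 0" for \<eta>
  proof -
    have "\<forall>\<^sub>F x in at 0. dist (sn \<kappa> x / x) m < \<eta> * m"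
      using lim \<open>m > 0\<close> that by (intro tendstoD) auto
    then obtain d where d: "d > 0" "\<And>x. x \<noteq> 0 \<Longrightarrow> dist x 0 < d \<Longrightarrow> dist (sn \<kappa> x / x) m < \<eta> * m"
      unfolding eventually_at by blast
    have "(1 - \<eta>) * m * x \<le> sn \<kappa> x \<and> sn \<kappa> x \<le> (1 + \<eta>) * m * x" if "x \<in> {0..d/2}" for x
    proof (cases "x = 0")
      case False
      then have x: "x > 0" "dist x 0 < d" using that d(1) by auto
      then have "\<bar>sn \<kappa> x / x - m\<bar> < \<eta> * m" using d(2)[of x] by (simp add: dist_real_def)
      then have "(1 - \<eta>) * m < sn \<kappa> x / x" "sn \<kappa> x / x < (1 + \<eta>) * m"
        by (auto simp: abs_less_iff algebra_simps)
      then show ?thesis using x by (simp add: field_simps)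
    qed simp
    then show ?thesis using d(1) by (intro exI[of _ "d/2"]) auto
  qed
  with \<open>m > 0\<close> that show ?thesis by blast
qed

lemma geodesic_path_exists:
  fixes x y :: "'a::metric_space"
  assumes "CAT_space \<kappa> TYPE('a)" "freq \<kappa> * dist x y < pi"
  obtains c where "geodesic_path c (dist x y) x y"
proof -
  obtain S where "geodesic_segment x y S"
    using assms less_D_bound_iff[OF zero_le_dist, of x y \<kappa>] unfolding CAT_space_def by blast
  then show ?thesis
    using that geodesic_path_length by (metis geodesic_segmentE)
qed

lemma geodesic_path_length_diff:
  assumes "geodesic_path c L a b" "geodesic_path c' L' a b'"
  shows "\<bar>L - L'\<bar> \<le> dist b b'"
  using geodesic_path_length[OF assms(1)] geodesic_path_length[OF assms(2)]
    dist_triangle[of a b b'] dist_triangle[of a b' b] by (simp add: dist_commute)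

text \<open>Eliminating \<open>k\<close> from \<open>haversine_comparison\<close> at equal times
  bounds \<open>(sn (d / 2))\<^sup>2\<close> by
  \<open>(sn t)\<^sup>2 * (sn (D / 2))\<^sup>2 / (sn L * sn L')\<close>, which tends to 0 with the
  endpoint distance \<open>D\<close>, uniformly in \<open>t\<close>. The clamp
  \<open>min t L\<close> accounts for \<open>L'\<close> exceeding \<open>L\<close>.\<close>

lemma geodesics_close:
  fixes c :: "real \<Rightarrow> 'a::metric_space"
  assumes cat: "CAT_space \<kappa> TYPE('a)"
    and c: "geodesic_path c L a b" and L: "freq \<kappa> * L < pi" and "\<rho> > 0"
  shows "\<exists>\<eta>>0. \<forall>b' c' L'. dist b b' < \<eta> \<longrightarrow> geodesic_path c' L' a b' \<longrightarrow>
           (\<forall>t\<in>{0..L'}. dist (c (min t L)) (c' t) \<le> \<rho>)"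
\<comment> \<open>Here \<open>sn L = 0\<close> and the quotient makes no sense, but all of
  \<open>c'\<close> is within \<open>dist b b'\<close> of \<open>a\<close>.\<close>
proof (cases "L = 0")
  case True
  have "dist (c (min t L)) (c' t) \<le> \<rho>"
    if "dist b b' < \<rho>" "geodesic_path c' L' a b'" "t \<in> {0..L'}" for b' c' L' t
  proof -
    have "a = b" using geodesic_path_ends[OF c] True by simp
    moreover have "L' = dist a b'" using geodesic_path_length that(2) by blast
    ultimately have "t \<le> \<rho>" using that by simp
    moreover have "dist (c 0) (c' t) = t"
      using geodesic_path_dist[OF that(2), of 0 t] geodesic_path_ends[OF that(2)]
        geodesic_path_ends[OF c] that(3) by simp
    ultimately show ?thesis using True that(3) by simp
  qed
  then show ?thesis using \<open>\<rho> > 0\<close> by blast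
next
  case False
  then have "L > 0" using geodesic_path_ends(3)[OF c] by simp
  then have snL: "sn \<kappa> L > 0" using L by (rule sn_pos)
  \<comment> \<open>\<open>\<rho>\<close> is shrunk into the range where \<open>sn\<close>
    increases; the summand 1 in the witness avoids dividing by zero when
    \<open>freq \<kappa> = 0\<close>.\<close>
  have "\<exists>\<sigma>>0. \<sigma> \<le> \<rho> \<and> freq \<kappa> * \<sigma> \<le> pi / 2"
  proof -
    have "freq \<kappa> * min \<rho> (pi / 2 / (freq \<kappa> + 1)) \<le> freq \<kappa> * (pi / 2 / (freq \<kappa> + 1))"
      by (intro mult_left_mono) auto
    also have "\<dots> = pi / 2 * (freq \<kappa> / (freq \<kappa> + 1))" by simp
    also have "\<dots> \<le> pi / 2 * 1"
      using freq_nonneg[of \<kappa>] by (intro mult_left_mono) (auto simp: divide_le_eq_1 add_nonneg_pos)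
    finally show ?thesis
      using \<open>\<rho> > 0\<close> freq_nonneg[of \<kappa>] by (intro exI[of _ "min \<rho> (pi / 2 / (freq \<kappa> + 1))"])
        (simp add: add_nonneg_pos)
  qed
  then obtain \<sigma> where \<sigma>: "\<sigma> > 0" "\<sigma> \<le> \<rho>" "freq \<kappa> * \<sigma> \<le> pi / 2" by blast
  have \<sigma>half: "freq \<kappa> * (\<sigma> / 2) < pi / 2"
    using \<sigma> pi_gt_zero by (simp del: pi_gt_zero)
  have sn\<sigma>: "sn \<kappa> (\<sigma> / 2) > 0"
    using \<sigma> \<sigma>half pi_gt_zero by (intro sn_pos) (simp_all del: pi_gt_zero)
  have "continuous_on {0..L} (sn \<kappa>)"
    by (intro continuous_at_imp_continuous_on ballI continuous_intros)
  then have "bounded (sn \<kappa> ` {0..L})"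
    by (intro compact_imp_bounded compact_continuous_image) auto
  then obtain B where B: "B > 0" "\<And>t. t \<in> {0..L} \<Longrightarrow> \<bar>sn \<kappa> t\<bar> \<le> B"
    unfolding bounded_pos by auto
  have ev: "\<forall>\<^sub>F x in nhds 0. P x" if "isCont f 0" "f 0 < C" "\<And>x. f x < C \<Longrightarrow> P x"
    for f :: "real \<Rightarrow> real" and C P
  proof -
    have "(f \<longlongrightarrow> f 0) (nhds 0)" using that(1) by (simp add: isCont_def tendsto_at_iff_tendsto_nhds)
    then have "\<forall>\<^sub>F x in nhds 0. f x < C" using that(2) by (rule order_tendstoD(2))
    then show ?thesis using that(3) by (rule eventually_mono)
  qed
  have "\<forall>\<^sub>F x in nhds 0. sn \<kappa> L / 2 < sn \<kappa> (L + x)"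
    by (rule ev[of "\<lambda>x. - sn \<kappa> (L + x)" "- sn \<kappa> L / 2"]) (use snL in \<open>auto intro!: continuous_intros\<close>)
  moreover have "\<forall>\<^sub>F x in nhds 0. B\<^sup>2 * (sn \<kappa> (x / 2))\<^sup>2 < (sn \<kappa> (\<sigma> / 2))\<^sup>2 * (sn \<kappa> L * (sn \<kappa> L / 2))"
    by (rule ev[of "\<lambda>x. B\<^sup>2 * (sn \<kappa> (x / 2))\<^sup>2" "(sn \<kappa> (\<sigma> / 2))\<^sup>2 * (sn \<kappa> L * (sn \<kappa> L / 2))"])
      (use snL sn\<sigma> in \<open>auto intro!: continuous_intros mult_pos_pos\<close>)
  moreover have "\<forall>\<^sub>F x in nhds 0. freq \<kappa> * (2 * L + 2 * x) < 2 * pi"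
    by (rule ev[of "\<lambda>x. freq \<kappa> * (2 * L + 2 * x)"]) (use L in \<open>auto intro!: continuous_intros\<close>)
  ultimately have "\<forall>\<^sub>F x in nhds 0. sn \<kappa> L / 2 < sn \<kappa> (L + x) \<and>
      B\<^sup>2 * (sn \<kappa> (x / 2))\<^sup>2 < (sn \<kappa> (\<sigma> / 2))\<^sup>2 * (sn \<kappa> L * (sn \<kappa> L / 2)) \<and>
      freq \<kappa> * (2 * L + 2 * x) < 2 * pi"
    by eventually_elim simp
  \<comment> \<open>The first bound is used with \<open>x = L' - L\<close>, the other two with
    \<open>x = dist b b'\<close>.\<close>
  then obtain e where e: "e > 0" and small: "\<And>x. \<bar>x\<bar> < e \<Longrightarrow> sn \<kappa> L / 2 < sn \<kappa> (L + x)"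
    "\<And>x. \<bar>x\<bar> < e \<Longrightarrow> B\<^sup>2 * (sn \<kappa> (x / 2))\<^sup>2 < (sn \<kappa> (\<sigma> / 2))\<^sup>2 * (sn \<kappa> L * (sn \<kappa> L / 2))"
    "\<And>x. \<bar>x\<bar> < e \<Longrightarrow> freq \<kappa> * (2 * L + 2 * x) < 2 * pi"
    unfolding eventually_nhds_metric by (auto simp: dist_real_def)
  have "dist (c (min t L)) (c' t) \<le> \<rho>"
    if b': "dist b b' < min e (\<rho> / 2)" and c': "geodesic_path c' L' a b'" and t: "t \<in> {0..L'}" for b' c' L' t
  proof -
    define D where "D = dist b b'"
    have D: "0 \<le> D" "\<bar>D\<bar> < e" "D < \<rho> / 2" using b' by (auto simp: D_def)
    have LL': "\<bar>L - L'\<bar> \<le> D" using geodesic_path_length_diff[OF c c'] by (simp add: D_def)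
    have L'0: "0 \<le> L'" using geodesic_path_ends(3)[OF c'] .
    show ?thesis
    proof (cases "t \<le> L")
      case False
      then have "dist (c (min t L)) (c' t) \<le> D + dist b' (c' t)"
        using dist_triangle[of b "c' t" b'] geodesic_path_ends(2)[OF c] by (simp add: D_def)
      also have "dist b' (c' t) = L' - t"
        using geodesic_path_dist[OF c', of L' t] geodesic_path_ends(2)[OF c'] t by simp
      finally show ?thesis using False LL' D by simp
    next
      case True
      have "freq \<kappa> * (L + L' + D) \<le> freq \<kappa> * (2 * L + 2 * D)"
        using LL' by (intro mult_left_mono) auto
      then have perim: "freq \<kappa> * (L + L' + dist b b') < 2 * pi"
        using small(3)[OF D(2)] by (simp add: D_def)
      obtain k where k: "0 \<le> k"
        "(sn \<kappa> (D / 2))\<^sup>2 = (sn \<kappa> ((L - L') / 2))\<^sup>2 + sn \<kappa> L * sn \<kappa> L' * k"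
        "\<And>s t. s \<in> {0..L} \<Longrightarrow> t \<in> {0..L'} \<Longrightarrow>
          (sn \<kappa> (dist (c s) (c' t) / 2))\<^sup>2 \<le> (sn \<kappa> ((s - t) / 2))\<^sup>2 + sn \<kappa> s * sn \<kappa> t * k"
        using haversine_comparison[OF cat c c' perim] unfolding D_def by metis
      define d where "d = dist (c t) (c' t)"
      have "(sn \<kappa> (d / 2))\<^sup>2 \<le> (sn \<kappa> t)\<^sup>2 * k"
        using k(3)[of t t] t True by (simp add: d_def power2_eq_square)
      also have "\<dots> \<le> B\<^sup>2 * k"
        using B(2)[of t] t True k(1) by (intro mult_right_mono abs_le_square_iff[THEN iffD1]) auto
      finally have d1: "(sn \<kappa> (d / 2))\<^sup>2 \<le> B\<^sup>2 * k" .
      have "sn \<kappa> L / 2 < sn \<kappa> L'"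
        using small(1)[of "L' - L"] LL' D by simp
      then have "sn \<kappa> L * (sn \<kappa> L / 2) * k \<le> sn \<kappa> L * sn \<kappa> L' * k"
        using snL k(1) by (intro mult_right_mono mult_left_mono) auto
      also have "\<dots> \<le> (sn \<kappa> (D / 2))\<^sup>2" using k(2) by simp
      finally have "B\<^sup>2 * (sn \<kappa> L * (sn \<kappa> L / 2) * k) \<le> B\<^sup>2 * (sn \<kappa> (D / 2))\<^sup>2"
        by (intro mult_left_mono) auto
      also have "\<dots> < (sn \<kappa> (\<sigma> / 2))\<^sup>2 * (sn \<kappa> L * (sn \<kappa> L / 2))"
        using small(2) D by simp
      finally have "(sn \<kappa> L * (sn \<kappa> L / 2)) * (B\<^sup>2 * k) < (sn \<kappa> L * (sn \<kappa> L / 2)) * (sn \<kappa> (\<sigma> / 2))\<^sup>2"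
        by (simp add: mult_ac)
      then have "B\<^sup>2 * k < (sn \<kappa> (\<sigma> / 2))\<^sup>2"
        using snL by (subst (asm) mult_less_cancel_left_pos) auto
      with d1 have "(sn \<kappa> (d / 2))\<^sup>2 < (sn \<kappa> (\<sigma> / 2))\<^sup>2" by simp
      then have d2: "sn \<kappa> (d / 2) < sn \<kappa> (\<sigma> / 2)"
        using sn\<sigma> power2_less_imp_less by (meson less_imp_le)
      \<comment> \<open>Going round the triangle both ways gives
        \<open>2 * d \<le> L + L' + D\<close>. Hence \<open>d / 2\<close> lies where
        \<open>sn\<close> increases, and the bound on \<open>sn (d / 2)\<close> can be
        inverted.\<close>
      have "d \<le> t + t"
        using dist_triangle[of "c t" "c' t" a] geodesic_path_dist[OF c, of 0 t] geodesic_path_dist[OF c', of 0 t]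
          geodesic_path_ends(1)[OF c] geodesic_path_ends(1)[OF c'] t True
        by (simp add: d_def dist_commute)
      moreover have "d \<le> (L - t) + D + (L' - t)"
        using dist_triangle[of "c t" "c' t" b] dist_triangle[of b "c' t" b']
          geodesic_path_dist[OF c, of t L] geodesic_path_dist[OF c', of t L']
          geodesic_path_ends(2)[OF c] geodesic_path_ends(2)[OF c'] t True
        by (simp add: d_def D_def dist_commute)
      ultimately have "2 * d \<le> L + L' + D" by simp
      then have "freq \<kappa> * (d / 2) \<le> pi / 2"
        using mult_left_mono[of "2 * d" "L + L' + D" "freq \<kappa>"] perim by (simp add: D_def)
      then have "\<not> \<sigma> / 2 \<le> d / 2"
        using sn_mono[of "\<sigma> / 2" "d / 2" \<kappa>] d2 \<sigma> by auto
      then show ?thesis using \<sigma> True by (simp add: d_def min_def)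
    qed
  qed
  then show ?thesis using e \<open>\<rho> > 0\<close> by (intro exI[of _ "min e (\<rho> / 2)"]) auto
qed

text \<open>The Euclidean factor is 1/2; curvature changes it to about \<open>1 / (2 * q)\<close>.
  Comparison at the midpoints and the double-angle formula give
  \<open>2 * q * sn (d / 2) \<le> sn (D / 2)\<close>, and the strict gap between
  \<open>1 / (2 * q)\<close> and \<open>K\<close> absorbs the error of linearising
  \<open>sn\<close>.\<close>

lemma midpoint_contraction:
  assumes cat: "CAT_space \<kappa> TYPE('a::metric_space)"
    and H: "0 < H" "freq \<kappa> * H < pi / 2" and q: "0 < q" "\<And>x. x \<in> {0..H} \<Longrightarrow> q \<le> cs \<kappa> x"
    and K: "1 / (2 * q) < K"
  shows "\<exists>r>0. \<forall>(x::'a) y y' c c' L L'. geodesic_path c L x y \<longrightarrow> geodesic_path c' L' x y' \<longrightarrow>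
           L \<le> 2 * H \<longrightarrow> L' \<le> 2 * H \<longrightarrow> dist y y' \<le> r \<longrightarrow>
           dist (c (L / 2)) (c' (L' / 2)) \<le> K * dist y y'"
proof -
  have qK: "1 < 2 * q * K" using K q by (simp add: field_simps)
  \<comment> \<open>The linearisation error for which
    \<open>(1 + \<eta>) / (1 - \<eta>) = 2 * q * K\<close> exactly.\<close>
  define \<eta> where "\<eta> = (2 * q * K - 1) / (2 * q * K + 1)"
  have \<eta>: "0 < \<eta>" "\<eta> < 1" using qK by (auto simp: \<eta>_def)
  have \<eta>K: "1 + \<eta> = (1 - \<eta>) * (2 * q * K)"
    using qK by (simp add: \<eta>_def field_simps)
  obtain m \<rho>' where m: "m > 0" "\<rho>' > 0"
    "\<And>x. x \<in> {0..\<rho>'} \<Longrightarrow> (1 - \<eta>) * m * x \<le> sn \<kappa> x" "\<And>x. x \<in> {0..\<rho>'} \<Longrightarrow> sn \<kappa> x \<le> (1 + \<eta>) * m * x"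
    using sn_asymptotically_linear[of \<kappa>] \<eta>(1) by metis
  define \<rho> where "\<rho> = min \<rho>' H"
  have \<rho>: "0 < \<rho>" "\<rho> \<le> \<rho>'" "\<rho> \<le> H" using m H by (auto simp: \<rho>_def)
  have \<rho>H: "freq \<kappa> * \<rho> \<le> freq \<kappa> * H" using \<rho> by (intro mult_left_mono) auto
  then have sn\<rho>: "sn \<kappa> \<rho> > 0"
    using H \<rho> pi_gt_zero by (intro sn_pos) (simp_all del: pi_gt_zero)
  have lim: "((\<lambda>x. sn \<kappa> (x / 2)) \<longlongrightarrow> sn \<kappa> (0 / 2)) (at_right 0)"
    "((\<lambda>x. freq \<kappa> * (4 * H + x)) \<longlongrightarrow> freq \<kappa> * (4 * H + 0)) (at_right 0)"
    by (intro isCont_tendsto_compose[of 0 "\<lambda>x. sn \<kappa> (x / 2)"] continuous_intros tendsto_intros; simp)+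
  moreover have "sn \<kappa> (0 / 2) < 2 * q * sn \<kappa> \<rho>" "freq \<kappa> * (4 * H + 0) < 2 * pi"
    using sn\<rho> q(1) H(2) by (auto simp: algebra_simps)
  ultimately have "\<forall>\<^sub>F x in at_right 0. sn \<kappa> (x / 2) < 2 * q * sn \<kappa> \<rho>"
    "\<forall>\<^sub>F x in at_right 0. freq \<kappa> * (4 * H + x) < 2 * pi"
    using order_tendstoD(2)[OF lim(1)] order_tendstoD(2)[OF lim(2)] by blast+
  then have "\<forall>\<^sub>F x in at_right 0. sn \<kappa> (x / 2) < 2 * q * sn \<kappa> \<rho> \<and> freq \<kappa> * (4 * H + x) < 2 * pi"
    by eventually_elim simp
  then obtain e where e: "e > 0" and small: "\<And>x. 0 < x \<Longrightarrow> x < e \<Longrightarrow> sn \<kappa> (x / 2) < 2 * q * sn \<kappa> \<rho>"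
    "\<And>x. 0 < x \<Longrightarrow> x < e \<Longrightarrow> freq \<kappa> * (4 * H + x) < 2 * pi"
    unfolding eventually_at_right_field by auto
  define r where "r = min (e / 2) \<rho>"
  have r: "0 < r" "r < e" "r \<le> \<rho>" using e \<rho> by (auto simp: r_def)
  have "dist (c (L / 2)) (c' (L' / 2)) \<le> K * dist y y'"
    if c: "geodesic_path c L x y" and c': "geodesic_path c' L' x y'"
      and LH: "L \<le> 2 * H" "L' \<le> 2 * H" and D: "dist y y' \<le> r" for x y y' :: 'a and c c' L L'
  proof -
    have L0: "0 \<le> L" "0 \<le> L'" using geodesic_path_ends(3)[OF c] geodesic_path_ends(3)[OF c'] by auto
    define d where "d = dist (c (L / 2)) (c' (L' / 2))"
    define D where "D = dist y y'"
    have D0: "0 \<le> D" "D \<le> r" using D by (auto simp: D_def)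
    have "freq \<kappa> * (L + L' + D) \<le> freq \<kappa> * (4 * H + r)"
      using LH D0 by (intro mult_left_mono) auto
    then have perim: "freq \<kappa> * (L + L' + dist y y') < 2 * pi"
      using small(2)[of r] r by (simp add: D_def)
    obtain k where k: "0 \<le> k"
        "(sn \<kappa> (D / 2))\<^sup>2 = (sn \<kappa> ((L - L') / 2))\<^sup>2 + sn \<kappa> L * sn \<kappa> L' * k"
        "\<And>s t. s \<in> {0..L} \<Longrightarrow> t \<in> {0..L'} \<Longrightarrow>
          (sn \<kappa> (dist (c s) (c' t) / 2))\<^sup>2 \<le> (sn \<kappa> ((s - t) / 2))\<^sup>2 + sn \<kappa> s * sn \<kappa> t * k"
      using haversine_comparison[OF cat c c' perim] unfolding D_def by metis
    define \<Delta> where "\<Delta> = (L - L') / 4"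
    have csq: "q \<le> cs \<kappa> (L / 2)" "q \<le> cs \<kappa> (L' / 2)" "q \<le> cs \<kappa> \<Delta>"
    proof -
      have "cs \<kappa> \<Delta> = cs \<kappa> \<bar>\<Delta>\<bar>" by (simp add: abs_if)
      moreover have "\<bar>\<Delta>\<bar> \<le> H" using L0 LH by (auto simp: \<Delta>_def)
      ultimately show "q \<le> cs \<kappa> \<Delta>" using q(2)[of "\<bar>\<Delta>\<bar>"] by simp
    qed (use q(2) L0 LH in auto)
    have snn: "0 \<le> sn \<kappa> (L / 2)" "0 \<le> sn \<kappa> (L' / 2)"
    proof -
      have "freq \<kappa> * (L / 2) \<le> freq \<kappa> * H" "freq \<kappa> * (L' / 2) \<le> freq \<kappa> * H"
        using LH by (intro mult_left_mono; simp)+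
      then show "0 \<le> sn \<kappa> (L / 2)" "0 \<le> sn \<kappa> (L' / 2)"
        using H L0 pi_gt_zero by (auto intro!: sn_nonneg simp del: pi_gt_zero)
    qed
    have "(2 * q * sn \<kappa> (d / 2))\<^sup>2 = 4 * q\<^sup>2 * (sn \<kappa> (d / 2))\<^sup>2" by (simp add: power_mult_distrib)
    also have "\<dots> \<le> 4 * q\<^sup>2 * ((sn \<kappa> \<Delta>)\<^sup>2 + sn \<kappa> (L / 2) * sn \<kappa> (L' / 2) * k)"
      using k(3)[of "L / 2" "L' / 2"] L0
      by (intro mult_left_mono) (auto simp: d_def \<Delta>_def diff_divide_distrib)
    also have "\<dots> = 4 * (q * q * (sn \<kappa> \<Delta>)\<^sup>2) + 4 * (q * q * (sn \<kappa> (L / 2) * sn \<kappa> (L' / 2) * k))"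
      by (simp add: power2_eq_square algebra_simps)
    \<comment> \<open>Each factor \<open>q\<close> is replaced by the value of \<open>cs\<close>
      with which \<open>sn_double\<close> doubles the argument.\<close>
    also have "\<dots> \<le> 4 * (cs \<kappa> \<Delta> * cs \<kappa> \<Delta> * (sn \<kappa> \<Delta>)\<^sup>2)
        + 4 * (cs \<kappa> (L / 2) * cs \<kappa> (L' / 2) * (sn \<kappa> (L / 2) * sn \<kappa> (L' / 2) * k))"
      using csq q(1) snn k(1) by (intro add_mono mult_left_mono mult_right_mono mult_mono) auto
    also have "\<dots> = (sn \<kappa> (2 * \<Delta>))\<^sup>2 + sn \<kappa> (2 * (L / 2)) * sn \<kappa> (2 * (L' / 2)) * k"
      unfolding sn_double by algebra
    also have "2 * \<Delta> = (L - L') / 2" by (simp add: \<Delta>_def)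
    also have "(sn \<kappa> ((L - L') / 2))\<^sup>2 + sn \<kappa> (2 * (L / 2)) * sn \<kappa> (2 * (L' / 2)) * k
        = (sn \<kappa> (D / 2))\<^sup>2"
      using k(2) by simp
    finally have "(2 * q * sn \<kappa> (d / 2))\<^sup>2 \<le> (sn \<kappa> (D / 2))\<^sup>2" .
    moreover have "0 \<le> sn \<kappa> (D / 2)"
    proof (rule sn_nonneg)
      have "freq \<kappa> * (D / 2) \<le> freq \<kappa> * \<rho>"
        using D0 r by (intro mult_left_mono) auto
      then show "freq \<kappa> * (D / 2) \<le> pi"
        using \<rho>H H pi_gt_zero by linarith
    qed (use D0 in auto)
    ultimately have main: "2 * q * sn \<kappa> (d / 2) \<le> sn \<kappa> (D / 2)"
      by (rule power2_le_imp_le)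
    have "d \<le> L / 2 + L' / 2"
      using dist_triangle[of "c (L / 2)" "c' (L' / 2)" x] geodesic_path_dist[OF c, of 0 "L / 2"]
        geodesic_path_dist[OF c', of 0 "L' / 2"] geodesic_path_ends(1)[OF c] geodesic_path_ends(1)[OF c'] L0
      by (simp add: d_def dist_commute)
    then have dH: "d / 2 \<le> H" using LH by simp
    have snD: "sn \<kappa> (D / 2) < 2 * q * sn \<kappa> \<rho>"
      using small(1)[of D] D0 r sn\<rho> q(1) by (cases "D = 0") auto
    \<comment> \<open>So far only \<open>d / 2 \<le> H\<close> is known, while linearisation needs
      \<open>\<rho>\<close>. A larger \<open>d\<close> would make \<open>sn (d / 2)\<close> at least
      \<open>sn \<rho>\<close>, too large for the chosen \<open>r\<close>.\<close>
    have "d / 2 \<le> \<rho>"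
    proof (rule ccontr)
      assume "\<not> d / 2 \<le> \<rho>"
      moreover have "freq \<kappa> * (d / 2) \<le> freq \<kappa> * H"
        using dH by (intro mult_left_mono) auto
      ultimately have "sn \<kappa> \<rho> \<le> sn \<kappa> (d / 2)"
        using \<rho> H by (intro sn_mono) auto
      then have "2 * q * sn \<kappa> \<rho> \<le> 2 * q * sn \<kappa> (d / 2)"
        using q(1) by (intro mult_left_mono) auto
      with main snD show False by simp
    qed
    then have "(1 - \<eta>) * m * (d / 2) \<le> sn \<kappa> (d / 2)"
      using m(3)[of "d / 2"] \<rho> by (simp add: d_def)
    then have "2 * q * ((1 - \<eta>) * m * (d / 2)) \<le> 2 * q * sn \<kappa> (d / 2)"
      using q(1) by (intro mult_left_mono) auto
    also have "\<dots> \<le> (1 + \<eta>) * m * (D / 2)"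
      using main m(4)[of "D / 2"] D0 r \<rho> by auto
    finally have "(2 * q * (1 - \<eta>) * m / 2) * d \<le> (2 * q * (1 - \<eta>) * m / 2) * (K * D)"
      unfolding \<eta>K by (simp add: mult_ac)
    then show ?thesis
      using q(1) \<eta> m(1) unfolding d_def D_def by (subst (asm) mult_le_cancel_left_pos) auto
  qed
  with r(1) show ?thesis by blast
qed

section \<open>A discrete maximum principle\<close>

text \<open>The weight \<open>sin (\<delta> + \<nu> i)\<close> is a positive strict supersolution of the recurrence.\<close>

lemma discrete_maximum_principle:
  fixes f :: "nat \<Rightarrow> real"
  assumes ends: "f 0 \<le> 0" "f N \<le> 0"
    and rec: "\<And>i. 0 < i \<Longrightarrow> i < N \<Longrightarrow> f i \<le> K * (f (i - 1) + f (i + 1))"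
    and K: "0 \<le> K" "2 * K * cos \<nu> < 1" and \<nu>: "0 \<le> \<nu>" "\<nu> * N < pi"
    and "i \<le> N"
  shows "f i \<le> 0"
proof (rule ccontr)
  assume "\<not> f i \<le> 0"
  \<comment> \<open>Centres the grid in the interval from 0 to \<pi>, so that the sine weights are
    positive up to both ends.\<close>
  define \<delta> where "\<delta> = (pi - \<nu> * N) / 2"
  define w where "w j = sin (\<delta> + \<nu> * real j)" for j
  have w: "w j > 0" if "j \<le> N" for j
    unfolding w_def
  proof (rule sin_gt_zero)
    have "\<nu> * real j \<le> \<nu> * real N" using that \<nu> by (intro mult_left_mono) auto
    then show "\<delta> + \<nu> * real j < pi" using \<nu> by (simp add: \<delta>_def field_simps)
    show "0 < \<delta> + \<nu> * real j" using \<nu> by (intro add_pos_nonneg) (auto simp: \<delta>_def)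
  qed
  \<comment> \<open>If some value of \<open>f\<close> is positive, this maximal ratio is positive
    and attained at an interior index, where the recurrence yields the contradiction
    \<open>f j < \<theta> * w j\<close>.\<close>
  define \<theta> where "\<theta> = Max ((\<lambda>j. f j / w j) ` {..N})"
  have "\<theta> \<in> (\<lambda>j. f j / w j) ` {..N}" unfolding \<theta>_def by (intro Max_in) auto
  then obtain j where j: "j \<le> N" "\<theta> = f j / w j" by auto
  have le: "f l \<le> \<theta> * w l" if "l \<le> N" for l
  proof -
    have "f l / w l \<le> \<theta>" unfolding \<theta>_def using that by (intro Max_ge) auto
    then show ?thesis using w[OF that] by (simp add: field_simps)
  qed
  have "\<theta> * w i > 0" using le[OF \<open>i \<le> N\<close>] \<open>\<not> f i \<le> 0\<close> by simp
  then have \<theta>: "\<theta> > 0" using w[OF \<open>i \<le> N\<close>] by (simp add: zero_less_mult_iff)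
  have fj: "f j = \<theta> * w j" using j w[OF j(1)] by simp
  then have "f j > 0" using \<theta> w[OF j(1)] by simp
  then have j': "0 < j" "j < N"
    using ends j(1) by (metis leD neq0_conv, metis leD le_neq_implies_less)
  have "f j \<le> K * (f (j - 1) + f (j + 1))" using rec j' by simp
  also have "\<dots> \<le> K * (\<theta> * w (j - 1) + \<theta> * w (j + 1))"
    using le j' K by (intro mult_left_mono add_mono) auto
  also have "\<dots> = \<theta> * w j * (2 * K * cos \<nu>)"
  proof -
    have "w (j - 1) + w (j + 1) = 2 * cos \<nu> * w j"
    proof -
      have "\<delta> + \<nu> * real (j - 1) = (\<delta> + \<nu> * real j) - \<nu>" "\<delta> + \<nu> * real (j + 1) = (\<delta> + \<nu> * real j) + \<nu>"
        using j' by (auto simp: algebra_simps of_nat_diff)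
      moreover have "sin (x - \<nu>) + sin (x + \<nu>) = 2 * cos \<nu> * sin x" for x
        by (simp add: sin_add sin_diff)
      ultimately show ?thesis unfolding w_def by (simp only:)
    qed
    then show ?thesis by (simp add: algebra_simps flip: distrib_left)
  qed
  also have "\<dots> < \<theta> * w j * 1"
    using K \<theta> w[OF j(1)] by (intro mult_strict_left_mono) auto
  finally show False using fj by simp
qed

subsection \<open>Geodesics in locally convex sets\<close>

lemma infdist_lessE:
  assumes "A \<noteq> {}" "infdist x A < e"
  obtains a where "a \<in> A" "dist x a < e"
  using assms by (auto simp: infdist_notempty cINF_less_iff bdd_below_image_dist)

text \<open>A Lebesgue number for the cover of \<open>C\<close> by balls of local convexity. Halving
  their radii first makes the clause that the geodesic stay in the ball automatic.\<close>

lemma locally_convex_uniform: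
  fixes A :: "'a::metric_space set"
  assumes lc: "locally_convex A" and C: "compact C" "C \<subseteq> A"
  obtains \<epsilon> where "\<epsilon> > 0"
    "\<And>p x y S. p \<in> C \<Longrightarrow> x \<in> A \<inter> ball p \<epsilon> \<Longrightarrow> y \<in> A \<inter> ball p \<epsilon> \<Longrightarrow> geodesic_segment x y S \<Longrightarrow> S \<subseteq> A"
proof -
  have "\<exists>e>0. \<forall>x\<in>A \<inter> ball p e. \<forall>y\<in>A \<inter> ball p e. \<forall>S. geodesic_segment x y S \<longrightarrow> S \<subseteq> A"
    if "p \<in> C" for p
  proof -
    have "locally_convex_at A p" using lc C that unfolding locally_convex_def by blast
    then obtain e where e0: "e > 0" and e': "\<forall>x\<in>A \<inter> ball p e. \<forall>y\<in>A \<inter> ball p e.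
        (\<exists>S. geodesic_segment x y S \<and> S \<subseteq> ball p e) \<and>
        (\<forall>S. geodesic_segment x y S \<and> S \<subseteq> ball p e \<longrightarrow> S \<subseteq> A)"
      unfolding locally_convex_at_def by (elim exE conjE)
    have e: "e > 0" "\<And>x y S. x \<in> A \<inter> ball p e \<Longrightarrow> y \<in> A \<inter> ball p e \<Longrightarrow>
        geodesic_segment x y S \<Longrightarrow> S \<subseteq> ball p e \<Longrightarrow> S \<subseteq> A"
      using e0 e' by simp_all
    have "S \<subseteq> A" if xy: "x \<in> A \<inter> ball p (e / 2)" "y \<in> A \<inter> ball p (e / 2)"
      and S: "geodesic_segment x y S" for x y S
    proof (rule e(2)[OF _ _ S])
      obtain c L where c: "geodesic_path c L x y" "S = c ` {0..L}"
        using S by (rule geodesic_segmentE)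
      show "S \<subseteq> ball p e"
      proof
        fix z assume "z \<in> S"
        then obtain t where t: "t \<in> {0..L}" "z = c t" using c(2) by auto
        have "dist x z = t" "dist z y = L - t"
          using geodesic_path_dist[OF c(1), of 0 t] geodesic_path_dist[OF c(1), of t L]
            geodesic_path_ends[OF c(1)] t by auto
        moreover have "L < e"
          using geodesic_path_length[OF c(1)] dist_triangle_half_r[of p x e y] xy by auto
        \<comment> \<open>Each point of a geodesic is within half its length of one
          endpoint.\<close>
        ultimately have "dist x z < e / 2 \<or> dist z y < e / 2" by auto
        then show "z \<in> ball p e"
          using dist_triangle[of p z x] dist_triangle[of p z y] xy by (auto simp: dist_commute)
      qed
    qed (use xy e(1) in auto)
    then show ?thesis using e(1) by (intro exI[of _ "e / 2"]) auto
  qed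
  then obtain e where e: "\<And>p. p \<in> C \<Longrightarrow> e p > 0"
    "\<And>p x y S. p \<in> C \<Longrightarrow> x \<in> A \<inter> ball p (e p) \<Longrightarrow> y \<in> A \<inter> ball p (e p) \<Longrightarrow>
       geodesic_segment x y S \<Longrightarrow> S \<subseteq> A"
    by metis
  obtain \<epsilon> where \<epsilon>: "0 < \<epsilon>" "\<And>x. x \<in> C \<Longrightarrow> \<exists>G \<in> (\<lambda>p. ball p (e p)) ` C. ball x \<epsilon> \<subseteq> G"
    by (rule Heine_Borel_lemma[OF C(1), of "(\<lambda>p. ball p (e p)) ` C"]) (use e(1) in auto)
  show ?thesis
  proof (rule that[OF \<epsilon>(1)])
    fix p x y S
    assume *: "p \<in> C" "x \<in> A \<inter> ball p \<epsilon>" "y \<in> A \<inter> ball p \<epsilon>" "geodesic_segment x y S"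
    obtain p' where "p' \<in> C" "ball p \<epsilon> \<subseteq> ball p' (e p')"
      using \<epsilon>(2)[OF *(1)] by blast
    with * show "S \<subseteq> A" by (intro e(2)[of p' x y S]) auto
  qed
qed

lemma geodesic_path_compact_image:
  assumes "geodesic_path c L x y"
  shows "compact (c ` {0..L})"
proof (rule compact_continuous_image)
  show "continuous_on {0..L} c"
    unfolding continuous_on_iff
  proof (intro ballI allI impI)
    fix s e assume "s \<in> {0..L}" "(0::real) < e"
    then show "\<exists>d>0. \<forall>t\<in>{0..L}. dist t s < d \<longrightarrow> dist (c t) (c s) < e"
      using geodesic_path_dist[OF assms] by (intro exI[of _ e]) (auto simp: dist_real_def)
  qed
qed simp

text \<open>The distance to \<open>A\<close> along the geodesic to the nearby point is compared, on a grid, with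
  the distance at the two neighbouring grid points: local convexity puts the midpoint of their
  approximate feet into \<open>A\<close>, and the discrete maximum principle forces the distance to vanish.\<close>

lemma geodesics_to_nearby_points_contained:
  fixes A :: "'a::metric_space set"
  assumes cat: "CAT_space \<kappa> TYPE('a)" and A: "closed A" "locally_convex A"
    and c: "geodesic_path c L a b" and cA: "c ` {0..L} \<subseteq> A" and L: "freq \<kappa> * L < pi"
  shows "\<exists>\<eta>>0. \<forall>b'\<in>A. dist b b' < \<eta> \<longrightarrow> (\<forall>S. geodesic_segment a b' S \<longrightarrow> S \<subseteq> A)"
proof -
  have L0: "0 \<le> L" and aA: "a \<in> A"
    using geodesic_path_ends[OF c] cA by (auto simp: image_subset_iff)
  obtain \<epsilon> where \<epsilon>: "\<epsilon> > 0"
    and \<epsilon>_conv: "\<And>u x y S. u \<in> {0..L} \<Longrightarrow> x \<in> A \<inter> ball (c u) \<epsilon> \<Longrightarrow> y \<in> A \<inter> ball (c u) \<epsilon> \<Longrightarrow>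
       geodesic_segment x y S \<Longrightarrow> S \<subseteq> A"
    using locally_convex_uniform[OF A(2) geodesic_path_compact_image[OF c] cA] by (metis imageI)
  \<comment> \<open>The bound 2 gives \<open>\<nu> < pi / 2\<close>; the other makes the grid step
    less than \<open>\<epsilon> / 8\<close>.\<close>
  obtain N :: nat where N: "real N > max 2 (8 * L / \<epsilon>)"
    using reals_Archimedean2 by blast
  then have N2: "real N > 2" "0 < N" and h0\<epsilon>: "L / N < \<epsilon> / 8"
    using \<epsilon> by (auto simp: field_simps)
  define h0 where "h0 = L / N"
  have h00: "0 \<le> h0" using L0 by (simp add: h0_def)
  \<comment> \<open>\<open>\<nu> * N\<close> is the mean of \<open>freq \<kappa> * L\<close> and
    \<pi>: the total angle stays below \<pi> while each step exceeds
    \<open>freq \<kappa> * h0\<close>.\<close>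
  define \<nu> where "\<nu> = (freq \<kappa> * L + pi) / (2 * N)"
  have \<nu>N: "\<nu> * N < pi" using L N2 by (simp add: \<nu>_def)
  have fh0: "freq \<kappa> * h0 < \<nu>" using L N2 by (simp add: \<nu>_def h0_def field_simps)
  have \<nu>0: "0 < \<nu>"
    unfolding \<nu>_def using L0 N2 by (intro divide_pos_pos add_nonneg_pos) auto
  have "\<nu> * 2 < \<nu> * N" using \<nu>0 N2 by simp
  then have \<nu>2: "\<nu> < pi / 2" using \<nu>N by simp
  have fh00: "0 \<le> freq \<kappa> * h0" using h00 by simp
  have cos\<nu>: "0 < cos \<nu>" using \<nu>0 \<nu>2 by (intro cos_gt_zero_pi) auto
  have "cos \<nu> < cos (freq \<kappa> * h0)"
    using fh0 fh00 \<nu>2 by (intro cos_monotone_0_pi) auto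
  \<comment> \<open>\<open>q\<close> and then \<open>K\<close> are squeezed in so that
    \<open>K\<close> is large enough for \<open>midpoint_contraction\<close> and small enough for
    \<open>discrete_maximum_principle\<close>.\<close>
  then obtain q where q: "cos \<nu> < q" "q < cos (freq \<kappa> * h0)" using dense by blast
  then have q0: "0 < q" using cos\<nu> by simp
  have "1 / (2 * q) < 1 / (2 * cos \<nu>)" using q cos\<nu> q0 by (simp add: field_simps)
  then obtain K where K: "1 / (2 * q) < K" "K < 1 / (2 * cos \<nu>)" using dense by blast
  have "0 < 1 / (2 * q)" using q0 by simp
  then have K0: "0 < K" using K(1) by linarith
  have K\<nu>: "2 * K * cos \<nu> < 1" using K(2) cos\<nu> by (simp add: field_simps)
  \<comment> \<open>Slack in the step length: the geodesic to \<open>b'\<close> may be longer than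
    \<open>c\<close>, and the feet in \<open>A\<close> lie off the grid points.\<close>
  obtain \<rho>0 where \<rho>0: "\<rho>0 > 0" "freq \<kappa> * (h0 + \<rho>0) < pi / 2" "q < cos (freq \<kappa> * (h0 + \<rho>0))"
    "h0 + \<rho>0 < \<epsilon> / 8"
  proof -
    have lim: "((\<lambda>x. freq \<kappa> * (h0 + x)) \<longlongrightarrow> freq \<kappa> * (h0 + 0)) (at_right 0)"
      "((\<lambda>x. cos (freq \<kappa> * (h0 + x))) \<longlongrightarrow> cos (freq \<kappa> * (h0 + 0))) (at_right 0)"
      "((\<lambda>x. h0 + x) \<longlongrightarrow> h0 + 0) (at_right 0)"
      by (intro tendsto_intros)+
    have "\<forall>\<^sub>F x in at_right 0. freq \<kappa> * (h0 + x) < pi / 2"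
      by (rule order_tendstoD(2)[OF lim(1)]) (use fh0 \<nu>2 in auto)
    moreover have "\<forall>\<^sub>F x in at_right 0. q < cos (freq \<kappa> * (h0 + x))"
      by (rule order_tendstoD(1)[OF lim(2)]) (use q in auto)
    moreover have "\<forall>\<^sub>F x in at_right 0. h0 + x < \<epsilon> / 8"
      by (rule order_tendstoD(2)[OF lim(3)]) (use h0\<epsilon> in \<open>auto simp: h0_def\<close>)
    moreover have "\<forall>\<^sub>F x in at_right 0. (0::real) < x"
      by (rule eventually_at_right_less)
    ultimately have "\<forall>\<^sub>F x in at_right 0. 0 < x \<and> freq \<kappa> * (h0 + x) < pi / 2 \<and>
        q < cos (freq \<kappa> * (h0 + x)) \<and> h0 + x < \<epsilon> / 8"
      by eventually_elim simp
    then have "\<exists>x. 0 < x \<and> freq \<kappa> * (h0 + x) < pi / 2 \<and> q < cos (freq \<kappa> * (h0 + x)) \<and> h0 + x < \<epsilon> / 8"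
      by (rule eventually_happens'[rotated]) simp
    with that show ?thesis by blast
  qed
  define H where "H = h0 + \<rho>0"
  have H: "0 < H" "freq \<kappa> * H < pi / 2" using \<rho>0 h00 by (auto simp: H_def)
  have csH: "q \<le> cs \<kappa> x" if "x \<in> {0..H}" for x
  proof -
    have "freq \<kappa> * x \<le> freq \<kappa> * H" "freq \<kappa> * H \<le> pi"
      using that H(2) pi_gt_zero by (auto intro!: mult_left_mono simp del: pi_gt_zero)
    then have "cos (freq \<kappa> * H) \<le> cos (freq \<kappa> * x)"
      using that H by (intro cos_monotone_0_pi_le) auto
    then show ?thesis using cos_freq_le_cs[of \<kappa> x] \<rho>0(3) by (simp add: H_def)
  qed
  obtain r where r: "r > 0" and mid: "\<And>(x::'a) y y' c c' L L'. geodesic_path c L x y \<Longrightarrow>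
      geodesic_path c' L' x y' \<Longrightarrow> L \<le> 2 * H \<Longrightarrow> L' \<le> 2 * H \<Longrightarrow> dist y y' \<le> r \<Longrightarrow>
      dist (c (L / 2)) (c' (L' / 2)) \<le> K * dist y y'"
    using midpoint_contraction[OF cat H q0 csH K(1)] by metis
  define \<rho> where "\<rho> = min (r / 2) (min (\<rho>0 / 4) (\<epsilon> / 8))"
  have \<rho>: "0 < \<rho>" "2 * \<rho> \<le> r" "4 * \<rho> \<le> \<rho>0" "\<rho> \<le> \<epsilon> / 8" using r \<rho>0(1) \<epsilon> by (auto simp: \<rho>_def)
  obtain \<eta>0 where \<eta>0: "\<eta>0 > 0" and close: "\<And>b' c' L' t. dist b b' < \<eta>0 \<Longrightarrow> geodesic_path c' L' a b' \<Longrightarrow>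
      t \<in> {0..L'} \<Longrightarrow> dist (c (min t L)) (c' t) \<le> \<rho>"
    using geodesics_close[OF cat c L \<rho>(1)] by metis
  define \<eta> where "\<eta> = min \<eta>0 (\<rho>0 / 2)"
  have "S \<subseteq> A" if b': "b' \<in> A" "dist b b' < \<eta>" and S: "geodesic_segment a b' S" for b' S
  proof -
    obtain c' L' where c': "geodesic_path c' L' a b'" and Sc': "S = c' ` {0..L'}"
      using S by (rule geodesic_segmentE)
    have L'0: "0 \<le> L'" using geodesic_path_ends(3)[OF c'] .
    have near: "dist (c (min t L)) (c' t) \<le> \<rho>" if "t \<in> {0..L'}" for t
      using close[OF _ c' that] b' by (simp add: \<eta>_def)
    have minL: "min t L \<in> {0..L}" if "t \<in> {0..L'}" for t using that L0 by auto
    define h where "h = L' / N"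
    have h0: "0 \<le> h" and hN: "h * N = L'" using L'0 N2 by (auto simp: h_def)
    \<comment> \<open>Half of the slack pays for \<open>L' > L\<close>; the other half pays for the
      feet, through \<open>4 * \<rho> \<le> \<rho>0\<close>.\<close>
    have hH: "h \<le> h0 + \<rho>0 / 2"
    proof -
      have "L' \<le> L + \<rho>0 / 2"
        using geodesic_path_length_diff[OF c c'] b'(2) unfolding \<eta>_def by linarith
      then have "h \<le> (L + \<rho>0 / 2) / N" unfolding h_def by (intro divide_right_mono) auto
      also have "\<dots> = h0 + (\<rho>0 / 2) / N" by (simp add: h0_def add_divide_distrib)
      also have "(\<rho>0 / 2) / N \<le> (\<rho>0 / 2) / 1"
        using \<rho>0(1) N2 by (intro divide_left_mono) auto
      finally show ?thesis by simp
    qed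
    have h\<epsilon>: "h < \<epsilon> / 8" using hH \<rho>0 by simp
    have grid: "real i * h \<in> {0..L'}" if "i \<le> N" for i
      using that h0 mult_right_mono[of "real i" "real N" h] hN by (auto simp: mult.commute)
    define z where "z i = c' (real i * h)" for i
    define f where "f i = infdist (z i) A" for i
    have f\<rho>: "f i \<le> \<rho>" if "i \<le> N" for i
      unfolding f_def z_def
    proof (rule infdist_le2)
      show "c (min (real i * h) L) \<in> A" using minL[OF grid[OF that]] cA by blast
      show "dist (c' (real i * h)) (c (min (real i * h) L)) \<le> \<rho>"
        using near[OF grid[OF that]] by (simp add: dist_commute)
    qed
    have f_ends: "f 0 = 0" "f N = 0"
      using geodesic_path_ends[OF c'] aA b'(1) hN by (auto simp: f_def z_def mult.commute)
    have zz: "dist (z i) (z j) = \<bar>real i * h - real j * h\<bar>" if "i \<le> N" "j \<le> N" for i j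
      unfolding z_def using geodesic_path_dist[OF c' grid[OF that(1)] grid[OF that(2)]] .
    have "f i \<le> K * (f (i - 1) + f (i + 1))" if i: "0 < i" "i < N" for i
    \<comment> \<open>The distance to \<open>A\<close> need not be attained, so feet are chosen up
      to an error \<open>\<zeta>\<close>, at a total cost of
      \<open>2 * K * \<zeta> \<le> e\<close>.\<close>
    proof (rule field_le_epsilon)
      fix e :: real assume "e > 0"
      have iN: "i - 1 \<le> N" "i \<le> N" "i + 1 \<le> N" and i1: "real (i - 1) = real i - 1"
        using i by auto
      define \<zeta> where "\<zeta> = min (e / (2 * K)) (\<rho> / 2)"
      define u where "u = c (min (real i * h) L)"
      have \<zeta>: "\<zeta> > 0" "\<zeta> < \<rho>" "2 * K * \<zeta> \<le> e"
        using \<open>e > 0\<close> K0 \<rho>(1) by (auto simp: \<zeta>_def field_simps min_def)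
      have A_ne: "A \<noteq> {}" using aA by blast
      obtain p where p: "p \<in> A" "dist (z (i - 1)) p < f (i - 1) + \<zeta>"
        using infdist_lessE[OF A_ne, of "z (i - 1)" "f (i - 1) + \<zeta>"] \<zeta>(1) unfolding f_def by auto
      obtain p' where p': "p' \<in> A" "dist (z (i + 1)) p' < f (i + 1) + \<zeta>"
        using infdist_lessE[OF A_ne, of "z (i + 1)" "f (i + 1) + \<zeta>"] \<zeta>(1) unfolding f_def by auto
      have p\<rho>: "dist (z (i - 1)) p < 2 * \<rho>" "dist (z (i + 1)) p' < 2 * \<rho>"
        using p(2) p'(2) f\<rho>[OF iN(1)] f\<rho>[OF iN(3)] \<zeta>(2) by linarith+
      have zi: "dist (z (i - 1)) (z i) = h" "dist (z (i + 1)) (z i) = h"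
        "dist (z (i - 1)) (z (i + 1)) = 2 * h"
        using zz[OF iN(1,2)] zz[OF iN(3,2)] zz[OF iN(1,3)] h0
        unfolding i1 by (simp_all add: algebra_simps)
      have uz: "dist u (z i) \<le> \<rho>" using near[OF grid[of i]] i by (simp add: u_def z_def)
      have "dist u p < \<epsilon>"
        using p\<rho>(1) zi(1) uz h\<epsilon> \<rho>(4) \<epsilon> dist_triangle[of u p "z i"] dist_triangle[of "z i" p "z (i - 1)"]
          dist_commute[of "z i" "z (i - 1)"] by linarith
      moreover have "dist u p' < \<epsilon>"
        using p\<rho>(2) zi(2) uz h\<epsilon> \<rho>(4) \<epsilon> dist_triangle[of u p' "z i"] dist_triangle[of "z i" p' "z (i + 1)"]
          dist_commute[of "z i" "z (i + 1)"] by linarith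
      ultimately have pu: "p \<in> A \<inter> ball u \<epsilon>" "p' \<in> A \<inter> ball u \<epsilon>"
        using p(1) p'(1) by auto
      have "dist (z (i - 1)) p' \<le> 2 * h + 2 * \<rho>"
        using dist_triangle[of "z (i - 1)" p' "z (i + 1)"] p\<rho>(2) unfolding zi(3) by linarith
      moreover from this have "dist p p' \<le> 2 * h + 4 * \<rho>"
        using dist_triangle[of p p' "z (i - 1)"] dist_commute[of p "z (i - 1)"] p\<rho>(1) by linarith
      moreover have "2 * h + 4 * \<rho> \<le> 2 * H" using hH \<rho>(3) by (simp add: H_def)
      ultimately have pp: "dist p p' \<le> 2 * H" "dist (z (i - 1)) p' \<le> 2 * H"
        using \<rho>(1) by linarith+
      have short: "freq \<kappa> * x < pi" if "x \<le> 2 * H" for x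
        using mult_left_mono[OF that freq_nonneg[of \<kappa>]] H by simp
      obtain g1 where g1: "geodesic_path g1 (dist p p') p p'"
        using geodesic_path_exists[OF cat short[OF pp(1)]] by blast
      \<comment> \<open>A diagonal of the quadrilateral \<open>z (i - 1)\<close>,
        \<open>z (i + 1)\<close>, \<open>p'\<close>, \<open>p\<close>. Contraction is applied to the
        triangles on its two sides, first from the vertex \<open>z (i - 1)\<close>, then with
        reversed geodesics from \<open>p'\<close>.\<close>
      obtain g2 where g2: "geodesic_path g2 (dist (z (i - 1)) p') (z (i - 1)) p'"
        using geodesic_path_exists[OF cat short[OF pp(2)]] by blast
      have eqs: "real (i - 1) * h + 2 * h / 2 = real i * h"
        "real (i + 1) * h - real (i - 1) * h = 2 * h"
        unfolding i1 by (simp_all add: field_simps)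
      have "geodesic_path (\<lambda>t. c' (real (i - 1) * h + t)) (real (i + 1) * h - real (i - 1) * h)
          (z (i - 1)) (z (i + 1))"
        unfolding z_def using grid[OF iN(1)] grid[OF iN(3)] h0
        by (intro geodesic_path_subpath[OF c']) (auto intro!: mult_right_mono)
      from mid[OF this g2 _ pp(2)]
      have m1: "dist (z i) (g2 (dist (z (i - 1)) p' / 2)) \<le> K * dist (z (i + 1)) p'"
        unfolding eqs(2) eqs(1) z_def[of i] using hH \<rho>0(1) p\<rho> \<rho>(2) by (simp add: H_def)
      have m2: "dist (g2 (dist (z (i - 1)) p' / 2)) (g1 (dist p p' / 2)) \<le> K * dist (z (i - 1)) p"
        using mid[OF geodesic_path_reverse[OF g2] geodesic_path_reverse[OF g1] pp(2) pp(1)] p\<rho> \<rho>(2)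
        by simp
      have "g1 ` {0..dist p p'} \<subseteq> A"
        using \<epsilon>_conv[OF minL[OF grid[of i]] pu[unfolded u_def] geodesic_path_segment[OF g1]] i by simp
      then have "g1 (dist p p' / 2) \<in> A" by auto
      then have "f i \<le> dist (z i) (g1 (dist p p' / 2))"
        unfolding f_def by (rule infdist_le)
      also have "\<dots> \<le> K * dist (z (i + 1)) p' + K * dist (z (i - 1)) p"
        using dist_triangle[of "z i" "g1 (dist p p' / 2)" "g2 (dist (z (i - 1)) p' / 2)"] m1 m2 by simp
      also have "\<dots> \<le> K * (f (i + 1) + \<zeta>) + K * (f (i - 1) + \<zeta>)"
        using p(2) p'(2) K0 by (intro add_mono mult_left_mono) auto
      also have "\<dots> = K * (f (i - 1) + f (i + 1)) + 2 * K * \<zeta>" by (simp add: algebra_simps)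
      finally show "f i \<le> K * (f (i - 1) + f (i + 1)) + e" using \<zeta>(3) by simp
    qed
    then have "f i \<le> 0" if "i \<le> N" for i
      using discrete_maximum_principle[of f N K \<nu> i] f_ends K0 K\<nu> \<nu>0 \<nu>N that by simp
    then have zA: "z i \<in> A" if "i \<le> N" for i
      using that infdist_nonneg[of "z i" A] A(1) aA
      by (subst in_closed_iff_infdist_zero) (force simp: f_def)+
    \<comment> \<open>The grid points are now in \<open>A\<close>; uniform local convexity fills in
      the pieces between neighbours.\<close>
    show "S \<subseteq> A"
      unfolding Sc'
    proof
      fix y assume "y \<in> c' ` {0..L'}"
      then obtain t where t: "t \<in> {0..L'}" "y = c' t" by blast
      show "y \<in> A"
      \<comment> \<open>At \<open>t = L'\<close> the floor index would be \<open>N\<close>, beyond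
        the last piece; this case also covers \<open>h = 0\<close>.\<close>
      proof (cases "t = L'")
        case True
        then show ?thesis using t b' geodesic_path_ends(2)[OF c'] by simp
      next
        case False
        then have "L' > 0" "t < L'" using t by auto
        then have hp: "h > 0" using N2 by (simp add: h_def)
        define i where "i = nat \<lfloor>t / h\<rfloor>"
        have "0 \<le> t / h" using t hp by simp
        then have "real i \<le> t / h" "t / h < real i + 1" by (auto simp: i_def)
        then have it: "real i * h \<le> t" "t \<le> real (i + 1) * h"
          using hp by (auto simp: field_simps)
        have "real i * h < real N * h" using it(1) \<open>t < L'\<close> hN by (simp add: mult.commute)
        then have iN: "i < N" using hp by simp
        define u where "u = c (min (real i * h) L)"
        have uz: "dist u (z i) \<le> \<rho>" using near[OF grid[of i]] iN by (simp add: u_def z_def)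
        have "dist (z i) (z (i + 1)) = h" using zz[of i "i + 1"] iN h0 by (auto simp: algebra_simps)
        then have zu: "z i \<in> A \<inter> ball u \<epsilon>" "z (i + 1) \<in> A \<inter> ball u \<epsilon>"
          using zA iN uz h\<epsilon> \<rho>(4) \<epsilon> dist_triangle[of u "z (i + 1)" "z i"] by auto
        have "geodesic_path (\<lambda>t. c' (real i * h + t)) (real (i + 1) * h - real i * h) (z i) (z (i + 1))"
          unfolding z_def using grid[of i] grid[of "i + 1"] iN h0
          by (intro geodesic_path_subpath[OF c']) (auto intro!: mult_right_mono)
        from \<epsilon>_conv[OF minL[OF grid[of i]] zu[unfolded u_def] geodesic_path_segment[OF this]]
        have "(\<lambda>t. c' (real i * h + t)) ` {0..real (i + 1) * h - real i * h} \<subseteq> A" using iN by simp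
        moreover have "t - real i * h \<in> {0..real (i + 1) * h - real i * h}" using it by auto
        ultimately have "c' (real i * h + (t - real i * h)) \<in> A" by blast
        then show ?thesis using t(2) by simp
      qed
    qed
  qed
  then show ?thesis using \<eta>0 \<rho>0(1) by (intro exI[of _ \<eta>]) (auto simp: \<eta>_def)
qed

text \<open>The property \<open>G\<close> is locally constant on \<open>B\<close>. Where it holds,
  it persists by \<open>geodesics_to_nearby_points_contained\<close>; where it fails, some geodesic
  has a point at positive distance from the closed set \<open>A\<close>, and
  \<open>geodesics_close\<close> keeps nearby geodesics near that point.\<close>

lemma geodesics_contained_of_connected:
  fixes A B :: "'a::metric_space set"
  assumes cat: "CAT_space \<kappa> TYPE('a)" and A: "closed A" "locally_convex A"
    and B: "connected B" "B \<subseteq> A" "a \<in> B" "\<And>x. x \<in> B \<Longrightarrow> freq \<kappa> * dist a x < pi"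
    and b: "b \<in> B" and S: "geodesic_segment a b S"
  shows "S \<subseteq> A"
proof -
  define G where "G x \<longleftrightarrow> (\<forall>S. geodesic_segment a x S \<longrightarrow> S \<subseteq> A)" for x
  have "G b"
  proof (rule connected_induction_simple[OF B(1,3) b])
    show "G a"
      unfolding G_def
    proof (intro allI impI)
      fix S assume "geodesic_segment a a S"
      then obtain c L where c: "geodesic_path c L a a" "S = c ` {0..L}" by (rule geodesic_segmentE)
      then have "S = {a}" using geodesic_path_length[OF c(1)] geodesic_path_ends(1)[OF c(1)] by simp
      then show "S \<subseteq> A" using B by auto
    qed
  next
    fix x assume x: "x \<in> B"
    have "\<exists>\<eta>>0. \<forall>u\<in>B. dist x u < \<eta> \<longrightarrow> (G u \<longleftrightarrow> G x)"
    proof (cases "G x")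
      case True
      obtain c where c: "geodesic_path c (dist a x) a x"
        using geodesic_path_exists[OF cat B(4)[OF x]] .
      have "c ` {0..dist a x} \<subseteq> A"
        using True geodesic_path_segment[OF c] unfolding G_def by blast
      from geodesics_to_nearby_points_contained[OF cat A c this B(4)[OF x]]
      obtain \<eta> where "\<eta> > 0" "\<forall>u\<in>A. dist x u < \<eta> \<longrightarrow> G u"
        unfolding G_def by (elim exE conjE)
      then show ?thesis using True B(2) by (intro exI[of _ \<eta>]) auto
    next
      case False
      then obtain S c L where S: "\<not> S \<subseteq> A" and c: "geodesic_path c L a x" "S = c ` {0..L}"
        unfolding G_def by (metis geodesic_segmentE)
      then obtain t where t: "t \<in> {0..L}" "c t \<notin> A" by blast
      obtain \<rho> where \<rho>: "\<rho> > 0" "\<And>y. dist y (c t) < \<rho> \<Longrightarrow> y \<notin> A"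
        using A(1) t(2) unfolding closed_def open_dist by auto
      have L: "freq \<kappa> * L < pi" using B(4)[OF x] geodesic_path_length[OF c(1)] by simp
      obtain \<eta> where \<eta>: "\<eta> > 0" and close: "\<And>b' c' L' t. dist x b' < \<eta> \<Longrightarrow>
          geodesic_path c' L' a b' \<Longrightarrow> t \<in> {0..L'} \<Longrightarrow> dist (c (min t L)) (c' t) \<le> \<rho> / 2"
        using geodesics_close[OF cat c(1) L, of "\<rho> / 2"] \<rho>(1) by auto
      have "\<not> G u" if u: "u \<in> B" "dist x u < min \<eta> (\<rho> / 2)" for u
      proof
        assume "G u"
        define L' where "L' = dist a u"
        obtain c' where c': "geodesic_path c' L' a u"
          using geodesic_path_exists[OF cat B(4)[OF u(1)]] unfolding L'_def .
        \<comment> \<open>The geodesic to \<open>u\<close> may end before time \<open>t\<close>, but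
          by at most \<open>dist x u\<close>.\<close>
        define t' where "t' = min t L'"
        have t': "t' \<in> {0..L'}" "t' \<in> {0..L}" "min t' L = t'"
          using t(1) by (auto simp: t'_def L'_def)
        have "\<bar>t' - t\<bar> \<le> dist x u"
          using geodesic_path_length_diff[OF c(1) c'] t(1) by (auto simp: t'_def)
        then have "dist (c t') (c t) < \<rho> / 2"
          using geodesic_path_dist[OF c(1) t'(2) t(1)] u(2) by simp
        moreover have "dist (c t') (c' t') \<le> \<rho> / 2"
          using close[OF _ c' t'(1)] u(2) t'(3) by simp
        ultimately have "dist (c' t') (c t) < \<rho>"
          using dist_triangle[of "c' t'" "c t" "c t'"] by (simp add: dist_commute)
        moreover have "c' t' \<in> A"
          using \<open>G u\<close> geodesic_path_segment[OF c'] t'(1) unfolding G_def by blast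
        ultimately show False using \<rho>(2) by blast
      qed
      then show ?thesis using False \<eta> \<rho>(1) by (intro exI[of _ "min \<eta> (\<rho> / 2)"]) auto
    qed
    then obtain \<eta> where \<eta>: "\<eta> > 0" "\<And>u. u \<in> B \<Longrightarrow> dist x u < \<eta> \<Longrightarrow> G u \<longleftrightarrow> G x" by blast
    show "\<exists>T. openin (top_of_set B) T \<and> x \<in> T \<and> (\<forall>u\<in>T. \<forall>v\<in>T. G u \<longrightarrow> G v)"
    proof (intro exI[of _ "B \<inter> ball x \<eta>"] conjI ballI impI)
      fix u v assume uv: "u \<in> B \<inter> ball x \<eta>" "v \<in> B \<inter> ball x \<eta>" and "G u"
      have "G u \<longleftrightarrow> G x" "G v \<longleftrightarrow> G x" using uv by (intro \<eta>(2); simp)+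
      with \<open>G u\<close> show "G v" by blast
    qed (use x \<eta>(1) in \<open>simp_all add: openin_open_Int\<close>)
  qed
  then show ?thesis using S unfolding G_def by blast
qed

section \<open>Short connecting paths and the conclusion\<close>

text \<open>The partition \<open>[0, t, 1]\<close> is admissible even for \<open>t = 0\<close> or
  \<open>t = 1\<close>, since \<open>sorted\<close> allows repetitions.\<close>

lemma dist_sum_le_path_length:
  assumes "t \<in> {0..1}"
  shows "ennreal (dist (\<gamma> 0) (\<gamma> t) + dist (\<gamma> t) (\<gamma> 1)) \<le> path_length \<gamma>"
proof -
  have "(\<Sum>i<length [0,t,1] - 1. ennreal (dist (\<gamma> ([0,t,1] ! i)) (\<gamma> ([0,t,1] ! Suc i)))) \<le> path_length \<gamma>"
    unfolding path_length_def using assms by (intro SUP_upper) auto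
  then show ?thesis by (simp add: numeral_2_eq_2)
qed

theorem mainTheorem1:
  fixes \<kappa> :: real and A :: "'a::complete_space set"
  assumes "CAT_space \<kappa> TYPE('a)"
    and "closed A" and "connected A"
    and "\<kappa> > 0 \<Longrightarrow> locally compact (UNIV :: 'a set)"
    and "\<kappa> > 0 \<Longrightarrow> length_diameter A \<le> D_bound \<kappa>"
    and "locally_convex A"
  shows "D_convex \<kappa> A"
  unfolding D_convex_def
proof (intro ballI impI conjI allI)
  fix a b assume ab: "a \<in> A" "b \<in> A" "ennreal (dist a b) < D_bound \<kappa>"
  then show "\<exists>S. geodesic_segment a b S"
    using assms(1) unfolding CAT_space_def by blast
  fix S assume S: "geodesic_segment a b S"
  have fab: "freq \<kappa> * dist a b < pi"
    using ab(3) less_D_bound_iff by (metis zero_le_dist)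
  \<comment> \<open>For \<kappa> \<le> 0 the distance condition reads \<open>0 < pi\<close> and
    \<open>A\<close> itself serves; for \<kappa> > 0 the image of a short path is taken.\<close>
  have "\<exists>B. connected B \<and> B \<subseteq> A \<and> a \<in> B \<and> b \<in> B \<and> (\<forall>x\<in>B. freq \<kappa> * dist a x < pi)"
  proof (cases "\<kappa> > 0")
    case False
    then show ?thesis using assms(3) ab by (intro exI[of _ A]) (auto simp: freq_nonpos)
  next
    case True
    define D where "D = pi / sqrt \<kappa>"
    have D: "D_bound \<kappa> = ennreal D" and fD: "freq \<kappa> * x < pi \<longleftrightarrow> x < D" for x
      using True by (auto simp: D_bound_def D_def freq_pos field_simps)
    have D0: "D > 0" using True by (simp add: D_def)
    have dab: "dist a b < D" using fab fD by blast
    have "length_metric A a b \<le> length_diameter A"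
      unfolding length_diameter_def using ab by (meson SUP_upper2 SUP_upper)
    also have "\<dots> \<le> ennreal D" using assms(5)[OF True] D by simp
    \<comment> \<open>\<open>dist a b < D\<close> leaves room strictly above \<open>D\<close>, so
      the infimum yields an actual path.\<close>
    also have "\<dots> < ennreal (2 * D - dist a b)"
      using dab D0 by (intro ennreal_lessI) auto
    finally obtain \<gamma> where \<gamma>: "path \<gamma>" "path_image \<gamma> \<subseteq> A" "pathstart \<gamma> = a" "pathfinish \<gamma> = b"
      and len: "path_length \<gamma> < ennreal (2 * D - dist a b)"
      unfolding length_metric_def INF_less_iff by blast
    have "dist a x < D" if "x \<in> path_image \<gamma>" for x
    proof -
      obtain t where t: "t \<in> {0..1}" "x = \<gamma> t" using \<open>x \<in> path_image \<gamma>\<close> unfolding path_image_def by blast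
      have "ennreal (dist a x + dist x b) < ennreal (2 * D - dist a b)"
        using le_less_trans[OF dist_sum_le_path_length[OF t(1), of \<gamma>] len] \<gamma> t(2)
        by (simp add: pathstart_def pathfinish_def)
      then have "dist a x + dist x b < 2 * D - dist a b"
        by (subst (asm) ennreal_less_iff) auto
      \<comment> \<open>Adding \<open>dist a x \<le> dist a b + dist b x\<close> gives
        \<open>2 * dist a x < 2 * D\<close>.\<close>
      then show ?thesis using dist_triangle[of a x b] by (simp add: dist_commute)
    qed
    then show ?thesis
      using \<gamma> fD connected_path_image pathstart_in_path_image pathfinish_in_path_image
      by (intro exI[of _ "path_image \<gamma>"]) auto
  qed
  then show "S \<subseteq> A"
    using geodesics_contained_of_connected[OF assms(1,2,6) _ _ _ _ _ S] by blast
qed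

end
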